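(* Let condition $\mathbf{L}(V,\varphi,\Psi)$ hold for the process $X$. Then for any $q,\varepsilon\in(0,1)$ there exists a constant $c_{\varepsilon,q}\in(0,1)$ such that $$\frac{c_{\varepsilon,q}}{L_{\varepsilon,q}(r)}\leq \pi(\{x\in\mathcal X:V(x)\geq r\})\qquad\text{for all } r\in[1,\infty),$$ where $L_{\varepsilon,q}(r)= r\,\varphi(1/r)\,\Psi(2r/(1-q))\,(\log\log r)^{\varepsilon}$ for $r\in[1,\infty)$.
   Context: Convention: $\mathbb R_+=[0,\infty)$; $\log x:=1$ for $x\in(0,\mathrm e)$ and $\log x$ is the natural logarithm for $x\in[\mathrm e,\infty)$; $\inf\emptyset=\infty$; "increasing/decreasing" means strictly. Setting: $X=(X_t)_{t\in\mathbb R_+}$ is a strong Markov process with c\`adl\`ag paths on a filtered space $(\Omega,\mathcal F,(\mathcal F_t)_{t\in\mathbb R_+})$, with values in a locally compact separable metric space $\mathcal X$ with Borel $\sigma$-algebra $\mathcal B(\mathcal X)$. $\mathbb P_x,\mathbb E_x$ denote the probability and expectation with $\mathbb P_x(X_0=x)=1$. Standing assumption: $X$ is ergodic and positive Harris recurrent with invariant probability measure $\pi$, i.e. (Harris recurrence) there is a $\sigma$-finite measure $\nu$ on $\mathcal B(\mathcal X)$ such that $\nu(A)>0$ implies $\mathbb P_x(\int_0^\infty \mathbf 1\{X_t\in A\}\,dt=\infty)=1$ for all $x$; (invariance) $\int_{\mathcal X}\mathbb E_x[g(X_t)]\pi(dx)=\int_{\mathcal X} g\,d\pi$ for all bounded measurable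 $g:\mathcal X\to\mathbb R_+$ and $t\ge0$; (ergodicity) $\lim_{t\to\infty}\|\mathbb P_x(X_t\in\cdot)-\pi(\cdot)\|_{\mathrm{TV}}=0$ for all $x$, where $\|\mu\|_{\mathrm{TV}}=\sup\{|\int g\,d\mu|: g \text{ measurable}, |g|\le1\}$. Condition $\mathbf L(V,\varphi,\Psi)$: $V:\mathcal X\to[1,\infty)$ is continuous with $\limsup_{t\to\infty}V(X_t)=\infty$ $\mathbb P_x$-a.s. for all $x\in\mathcal X$, and there exists $\ell_0\in[1,\infty)$ such that: (i) $\varphi:(0,1]\to\mathbb R_+$ is non-decreasing and continuous, $r\mapsto r\varphi(1/r)$ is decreasing on $[1,\infty)$, $\lim_{r\to\infty}r\varphi(1/r)=0$, and for some $b\in\mathbb R_+$ and any $x\in\mathcal X$ the process $1/V(X)-\int_0^\cdot\varphi(1/V(X_u))\,du-b\int_0^\cdot\mathbf 1\{V(X_u)\le\ell_0\}\,du$ is an $(\mathcal F_t)$-supermartingale under $\mathbb P_x$; (ii) $\Psi:[1,\infty)\to[1,\infty)$ is differentiable, increasing and submultiplicative (i.e. there is $C\in(0,\infty)$ with $\Psi(r_1+r_2)\le C\Psi(r_1)\Psi(r_2)$ for all $r_1,r_2\in[1,\infty)$), and for any $\ell\in(\ell_0,\infty)$ there is $C_\ell\in(0,\infty)$ with $\mathbb P_x(T^{(r)}<S_{(\ell)})\ge C_\ell/\Psi(r)$ for all $r\in(\ell+1,\infty)$ and $x\in\{\ell+1\le V\}$, where $T^{(r)}=\inf\{t\ge0:V(X_t)>r\}$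 and $S_{(\ell)}=\inf\{t\ge0:V(X_t)<\ell\}$. *)

theory Defs
  imports "HOL-Probability.Probability"
begin

text \<open>Time is \<open>real\<close>, and only times \<open>t \<ge> 0\<close> are ever constrained. Random times take values in
  \<open>ennreal\<close>, where the infimum of the empty set is \<open>\<infinity>\<close>. A sub-\<open>\<sigma>\<close>-algebra is represented by a
  measure of which only the space and the measurable sets matter.\<close>

definition random_stopping_time :: "(real \<Rightarrow> 'w measure) \<Rightarrow> ('w \<Rightarrow> ennreal) \<Rightarrow> bool" where
  "random_stopping_time F \<tau> \<longleftrightarrow>
     (\<forall>t\<ge>0. {\<omega> \<in> space (F t). \<tau> \<omega> \<le> ennreal t} \<in> sets (F t))"

definition sigma_at :: "'w measure \<Rightarrow> (real \<Rightarrow> 'w measure) \<Rightarrow> ('w \<Rightarrow> ennreal) \<Rightarrow> 'w measure" where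
  "sigma_at M F \<tau> = sigma (space M)
     {A \<in> sets M. \<forall>t\<ge>0. {\<omega> \<in> A. \<tau> \<omega> \<le> ennreal t} \<in> sets (F t)}"

definition cadlag :: "(real \<Rightarrow> 'x::topological_space) \<Rightarrow> bool" where
  "cadlag f \<longleftrightarrow> (\<forall>t\<ge>0. (f \<longlongrightarrow> f t) (at_right t)) \<and> (\<forall>t>0. \<exists>l. (f \<longlongrightarrow> l) (at_left t))"

text \<open>\<open>M\<close> carries the \<open>\<sigma>\<close>-algebra of the filtered space (its measure is irrelevant); \<open>P x\<close> is the
  law under which the process starts at \<open>x\<close>. The last assumption is the strong Markov property
  \<open>P\<^sub>x(X\<^sub>\<tau>\<^sub>+\<^sub>t \<in> B | F\<^sub>\<tau>) = P\<^sub>y(X\<^sub>t \<in> B)\<close> at \<open>y = X\<^sub>\<tau>\<close>, almost surely on \<open>\<tau> < \<infinity>\<close>.\<close>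

locale cadlag_strong_Markov =
  fixes M :: "'w measure"
    and F :: "real \<Rightarrow> 'w measure"
    and P :: "'x::metric_space \<Rightarrow> 'w measure"
    and X :: "real \<Rightarrow> 'w \<Rightarrow> 'x"
  assumes locally_compact: "locally_compact_space (euclidean :: 'x topology)"
    and separable: "separable_space (euclidean :: 'x topology)"
    and subalg: "\<And>t. 0 \<le> t \<Longrightarrow> subalgebra M (F t)"
    and filtration_mono: "\<And>s t. 0 \<le> s \<Longrightarrow> s \<le> t \<Longrightarrow> sets (F s) \<subseteq> sets (F t)"
    and prob: "\<And>x. prob_space (P x)"
    and sets_P: "\<And>x. sets (P x) = sets M"
    and adapted: "\<And>t. 0 \<le> t \<Longrightarrow> X t \<in> F t \<rightarrow>\<^sub>M borel"
    and cadlag_paths: "\<And>\<omega>. \<omega> \<in> space M \<Longrightarrow> cadlag (\<lambda>t. X t \<omega>)"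
    and start: "\<And>x. measure (P x) {\<omega> \<in> space M. X 0 \<omega> = x} = 1"
    and kernel: "\<And>t. 0 \<le> t \<Longrightarrow> (\<lambda>x. distr (P x) borel (X t)) \<in> borel \<rightarrow>\<^sub>M prob_algebra borel"
    and strong_Markov: "\<And>\<tau> t B x. random_stopping_time F \<tau> \<Longrightarrow> 0 \<le> t \<Longrightarrow> B \<in> sets borel \<Longrightarrow>
      (AE \<omega> in P x. \<tau> \<omega> < \<infinity> \<longrightarrow>
        real_cond_exp (P x) (sigma_at M F \<tau>)
          (\<lambda>\<omega>'. if \<tau> \<omega>' < \<infinity> then indicator B (X (enn2real (\<tau> \<omega>') + t) \<omega>') else 0) \<omega>
        = measure (P (X (enn2real (\<tau> \<omega>)) \<omega>)) {\<omega>' \<in> space M. X t \<omega>' \<in> B})"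

definition harris_recurrent :: "('x::metric_space \<Rightarrow> 'w measure) \<Rightarrow> (real \<Rightarrow> 'w \<Rightarrow> 'x) \<Rightarrow> bool" where
  "harris_recurrent P X \<longleftrightarrow>
     (\<exists>\<nu> :: 'x measure. sigma_finite_measure \<nu> \<and> sets \<nu> = sets borel \<and>
       (\<forall>A\<in>sets borel. emeasure \<nu> A > 0 \<longrightarrow>
         (\<forall>x. AE \<omega> in P x. (\<integral>\<^sup>+t\<in>{0..}. indicator A (X t \<omega>) \<partial>lborel) = \<infinity>)))"

definition invariant_prob ::
  "('x::metric_space \<Rightarrow> 'w measure) \<Rightarrow> (real \<Rightarrow> 'w \<Rightarrow> 'x) \<Rightarrow> 'x measure \<Rightarrow> bool" where
  "invariant_prob P X \<pi> \<longleftrightarrow> prob_space \<pi> \<and> sets \<pi> = sets borel \<and>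
     (\<forall>g :: 'x \<Rightarrow> real. g \<in> borel_measurable borel \<longrightarrow> (\<forall>x. 0 \<le> g x) \<longrightarrow> bounded (range g) \<longrightarrow>
       (\<forall>t\<ge>0. (\<integral>x. (\<integral>\<omega>. g (X t \<omega>) \<partial>P x) \<partial>\<pi>) = (\<integral>x. g x \<partial>\<pi>)))"

text \<open>Total variation norm of \<open>\<mu> - \<nu>\<close> for finite Borel measures, as a supremum over test functions
  bounded by \<open>1\<close> (so it ranges up to \<open>2\<close> for probability measures).\<close>

definition tv_norm_diff :: "'x::metric_space measure \<Rightarrow> 'x measure \<Rightarrow> real" where
  "tv_norm_diff \<mu> \<nu> =
     (SUP g \<in> {g :: 'x \<Rightarrow> real. g \<in> borel_measurable borel \<and> (\<forall>x. \<bar>g x\<bar> \<le> 1)}.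
        \<bar>(\<integral>x. g x \<partial>\<mu>) - (\<integral>x. g x \<partial>\<nu>)\<bar>)"

definition ergodic ::
  "('x::metric_space \<Rightarrow> 'w measure) \<Rightarrow> (real \<Rightarrow> 'w \<Rightarrow> 'x) \<Rightarrow> 'x measure \<Rightarrow> bool" where
  "ergodic P X \<pi> \<longleftrightarrow> (\<forall>x. ((\<lambda>t. tv_norm_diff (distr (P x) borel (X t)) \<pi>) \<longlongrightarrow> 0) at_top)"

definition supermartingale ::
  "'w measure \<Rightarrow> (real \<Rightarrow> 'w measure) \<Rightarrow> (real \<Rightarrow> 'w \<Rightarrow> real) \<Rightarrow> bool" where
  "supermartingale Q F Y \<longleftrightarrow>
     (\<forall>t\<ge>0. Y t \<in> borel_measurable (F t) \<and> integrable Q (Y t)) \<and>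
     (\<forall>s t. 0 \<le> s \<longrightarrow> s \<le> t \<longrightarrow> (AE \<omega> in Q. real_cond_exp Q (F s) (Y t) \<omega> \<le> Y s \<omega>))"

definition time_above :: "('x \<Rightarrow> real) \<Rightarrow> (real \<Rightarrow> 'w \<Rightarrow> 'x) \<Rightarrow> real \<Rightarrow> 'w \<Rightarrow> ennreal" where
  "time_above V X r \<omega> = Inf (ennreal ` {t. 0 \<le> t \<and> V (X t \<omega>) > r})"

definition time_below :: "('x \<Rightarrow> real) \<Rightarrow> (real \<Rightarrow> 'w \<Rightarrow> 'x) \<Rightarrow> real \<Rightarrow> 'w \<Rightarrow> ennreal" where
  "time_below V X l \<omega> = Inf (ennreal ` {t. 0 \<le> t \<and> V (X t \<omega>) < l})"

definition submultiplicative :: "(real \<Rightarrow> real) \<Rightarrow> bool" where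
  "submultiplicative \<Psi> \<longleftrightarrow> (\<exists>C>0. \<forall>r1\<ge>1. \<forall>r2\<ge>1. \<Psi> (r1 + r2) \<le> C * \<Psi> r1 * \<Psi> r2)"

definition L_drift ::
  "(real \<Rightarrow> 'w measure) \<Rightarrow> ('x::metric_space \<Rightarrow> 'w measure) \<Rightarrow> (real \<Rightarrow> 'w \<Rightarrow> 'x) \<Rightarrow>
   ('x \<Rightarrow> real) \<Rightarrow> (real \<Rightarrow> real) \<Rightarrow> real \<Rightarrow> bool" where
  "L_drift F P X V \<phi> l0 \<longleftrightarrow>
     (\<forall>u\<in>{0<..1}. 0 \<le> \<phi> u) \<and> mono_on {0<..1} \<phi> \<and> continuous_on {0<..1} \<phi> \<and>
     strict_antimono_on {1..} (\<lambda>r. r * \<phi> (1 / r)) \<and>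
     ((\<lambda>r. r * \<phi> (1 / r)) \<longlongrightarrow> 0) at_top \<and>
     (\<exists>b\<ge>0. \<forall>x. supermartingale (P x) F
        (\<lambda>t \<omega>. 1 / V (X t \<omega>) - (LBINT u:{0..t}. \<phi> (1 / V (X u \<omega>)))
           - b * (LBINT u:{0..t}. indicator {y. V y \<le> l0} (X u \<omega>))))"

definition L_tail ::
  "('x::metric_space \<Rightarrow> 'w measure) \<Rightarrow> (real \<Rightarrow> 'w \<Rightarrow> 'x) \<Rightarrow>
   ('x \<Rightarrow> real) \<Rightarrow> (real \<Rightarrow> real) \<Rightarrow> real \<Rightarrow> bool" where
  "L_tail P X V \<Psi> l0 \<longleftrightarrow>
     (\<forall>r\<ge>1. 1 \<le> \<Psi> r) \<and> \<Psi> differentiable_on {1..} \<and> strict_mono_on {1..} \<Psi> \<and>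
     submultiplicative \<Psi> \<and>
     (\<forall>l>l0. \<exists>C>0. \<forall>r>l + 1. \<forall>x. l + 1 \<le> V x \<longrightarrow>
        C / \<Psi> r \<le> measure (P x) {\<omega> \<in> space (P x). time_above V X r \<omega> < time_below V X l \<omega>})"

definition condition_L ::
  "(real \<Rightarrow> 'w measure) \<Rightarrow> ('x::metric_space \<Rightarrow> 'w measure) \<Rightarrow> (real \<Rightarrow> 'w \<Rightarrow> 'x) \<Rightarrow>
   ('x \<Rightarrow> real) \<Rightarrow> (real \<Rightarrow> real) \<Rightarrow> (real \<Rightarrow> real) \<Rightarrow> bool" where
  "condition_L F P X V \<phi> \<Psi> \<longleftrightarrow>
     (\<forall>x. 1 \<le> V x) \<and> continuous_on UNIV V \<and>
     (\<forall>x. AE \<omega> in P x. Limsup at_top (\<lambda>t. ereal (V (X t \<omega>))) = \<infinity>) \<and>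
     (\<exists>l0\<ge>1. L_drift F P X V \<phi> l0 \<and> L_tail P X V \<Psi> l0)"

text \<open>The logarithm truncated below at \<open>1\<close>; only meant for positive arguments.\<close>

definition tlog :: "real \<Rightarrow> real" where
  "tlog x = (if x < exp 1 then 1 else ln x)"

definition L_rate :: "(real \<Rightarrow> real) \<Rightarrow> (real \<Rightarrow> real) \<Rightarrow> real \<Rightarrow> real \<Rightarrow> real \<Rightarrow> real" where
  "L_rate \<phi> \<Psi> \<epsilon> q r =
     r * \<phi> (1 / r) * \<Psi> (2 * r / (1 - q)) * tlog (tlog r) powr \<epsilon>"

end

theory Submission
  imports Defs
begin

text \<open>The bound is Kac's formula for excursions of \<open>V(X)\<close> away from low levels. Fix a level \<open>l\<close> above
  \<open>l\<^sub>0\<close> with \<open>\<pi>(V < l) > 0\<close>. By stationarity, \<open>\<pi>(V \<ge> r)\<close> is at least the rate at which the process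
  crosses from \<open>{V < l}\<close> to \<open>{V \<ge> l + 1}\<close> within a fixed time \<open>h\<close>, times the mean time spent in \<open>{V \<ge> r}\<close> after such a crossing
  and before the next visit to \<open>{V < l}\<close>. That mean time is bounded in two stages.

  Put \<open>R = 2r / (1 - q)\<close>. The tail condition says that a fresh excursion climbs above \<open>R\<close> before it
  returns below \<open>l\<close> with probability at least \<open>C / \<Psi>(R)\<close>. Once above \<open>R\<close>, the process stays above \<open>r\<close>
  for a long time: \<open>1 / V\<close> starts below \<open>1 / R\<close>, has to grow to \<open>1 / r\<close>, and as long as it is below \<open>1 / r\<close>
  its drift is at most \<open>\<phi>(1 / r)\<close>. So the probability to have left \<open>{V \<ge> r}\<close> by time \<open>t\<close> is at most
  \<open>r / R + r \<phi>(1 / r) t\<close>, which is \<open>1 - q\<close> for \<open>t = (1 - q) / (2 r \<phi>(1 / r))\<close>. Altogether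
  \<open>\<pi>(V \<ge> r) \<ge> const / (r \<phi>(1 / r) \<Psi>(R))\<close> for \<open>r \<ge> l\<close>; the iterated logarithm in \<open>L_rate\<close> is at least
  \<open>1\<close>, and smaller \<open>r\<close> are covered by monotonicity of the tail.

  The crossing rate is positive because \<open>\<pi>\<close>-almost every path started below \<open>l\<close> would otherwise never
  exceed \<open>l + 1\<close>, contrary to \<open>limsup V(X\<^sub>t) = \<infinity>\<close> (\<open>exists_upcrossing_time\<close>).

  The filtration need not be right-continuous, so the times at which \<open>V(X)\<close> enters an open half-line need
  not be stopping times and the strong Markov property is not available there. The argument therefore
  runs on the grids \<open>h / 2^n\<close> and uses the Markov property at deterministic times only. On a grid
  the process is a Markov chain with stationary law \<open>\<pi>\<close>, excursions become the recursions
  \<open>occupation\<close> and \<open>reach\<close>, and Kac's inequality is \<open>occupation_after_steps_le\<close>. The two stages are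
  \<open>hitting_prob_le_liminf_reach\<close> and \<open>stay_above_prob_ge\<close>, and \<open>invariant_tail_ge\<close> lets the mesh tend to
  zero.\<close>

section \<open>Excursions of a stationary Markov chain\<close>

text \<open>The averaging operator of a kernel, on functions with values in \<open>[0, \<infinity>]\<close>: no integrability
  conditions appear, and iterates are powers \<open>kernel_op K ^^ N\<close>.\<close>
definition kernel_op :: "('a \<Rightarrow> 'a measure) \<Rightarrow> ('a \<Rightarrow> ennreal) \<Rightarrow> 'a \<Rightarrow> ennreal" where
  "kernel_op K g x = (\<integral>\<^sup>+y. g y \<partial>K x)"

lemma kernel_op_measurable:
  assumes "K \<in> S \<rightarrow>\<^sub>M prob_algebra S" and "g \<in> borel_measurable S"
  shows "kernel_op K g \<in> borel_measurable S"
  unfolding kernel_op_def[abs_def]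
  by (rule measurable_compose[OF measurable_prob_algebraD[OF assms(1)]
        nn_integral_measurable_subprob_algebra[OF assms(2)]])

lemma kernel_op_mono: "(\<And>y. g y \<le> g' y) \<Longrightarrow> kernel_op K g x \<le> kernel_op K g' x"
  unfolding kernel_op_def by (rule nn_integral_mono)

lemma kernel_op_pow_mono:
  "(\<And>y. g y \<le> g' y) \<Longrightarrow> (kernel_op K ^^ N) g x \<le> (kernel_op K ^^ N) g' x"
  by (induction N arbitrary: x) (auto intro: kernel_op_mono)

lemma kernel_op_cmult:
  assumes "g \<in> borel_measurable (K x)"
  shows "kernel_op K (\<lambda>y. u * g y) x = u * kernel_op K g x"
  unfolding kernel_op_def using assms by (rule nn_integral_cmult)

text \<open>For the chain \<open>Y\<^sub>0, Y\<^sub>1, \<dots>\<close> with kernel \<open>K\<close> started at \<open>x\<close>, this is the mean of the sum of \<open>f(Y\<^sub>k)\<close>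
  over the times \<open>k < n\<close> before the first visit to \<open>B\<close>. The recursion conditions on the first step, so
  no path space is needed.\<close>
primrec occupation ::
  "('a \<Rightarrow> 'a measure) \<Rightarrow> 'a set \<Rightarrow> ('a \<Rightarrow> ennreal) \<Rightarrow> nat \<Rightarrow> 'a \<Rightarrow> ennreal" where
  "occupation K B f 0 = (\<lambda>x. 0)"
| "occupation K B f (Suc n) = (\<lambda>x. indicator (- B) x * (f x + kernel_op K (occupation K B f n) x))"

text \<open>The probability that the chain enters \<open>D\<close> within \<open>m\<close> steps, without a visit to \<open>B\<close> before that.\<close>
primrec reach ::
  "('a \<Rightarrow> 'a measure) \<Rightarrow> 'a set \<Rightarrow> 'a set \<Rightarrow> nat \<Rightarrow> 'a \<Rightarrow> ennreal" where
  "reach K B D 0 = indicator D"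
| "reach K B D (Suc m) =
     (\<lambda>x. if x \<in> D then 1 else indicator (- B) x * kernel_op K (reach K B D m) x)"

lemma occupation_mono: "occupation K B f n x \<le> occupation K B f (Suc n) x"
proof (induction n arbitrary: x)
  case (Suc n)
  show ?case
    by (subst (1 2) occupation.simps(2), intro mult_left_mono add_left_mono kernel_op_mono Suc) auto
qed simp

lemma occupation_mono_le: "n \<le> m \<Longrightarrow> occupation K B f n x \<le> occupation K B f m x"
  by (rule lift_Suc_mono_le[where f="\<lambda>n. occupation K B f n x"]) (rule occupation_mono)

lemma occupation_measurable:
  assumes K: "K \<in> S \<rightarrow>\<^sub>M prob_algebra S" and sp: "space S = UNIV"
    and B: "B \<in> sets S" and f: "f \<in> borel_measurable S"
  shows "occupation K B f n \<in> borel_measurable S"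
proof (induction n)
  case (Suc n)
  have "- B \<in> sets S"
    using B sp sets.compl_sets[of B S] by (simp add: Compl_eq_Diff_UNIV)
  with Suc f show ?case
    by (auto intro!: borel_measurable_times_ennreal borel_measurable_add kernel_op_measurable[OF K])
qed auto

lemma reach_measurable:
  assumes K: "K \<in> S \<rightarrow>\<^sub>M prob_algebra S" and sp: "space S = UNIV"
    and B: "B \<in> sets S" and D: "D \<in> sets S"
  shows "reach K B D m \<in> borel_measurable S"
proof (induction m)
  case (Suc m)
  have "- B \<in> sets S"
    using B sp sets.compl_sets[of B S] by (simp add: Compl_eq_Diff_UNIV)
  with Suc D show ?case
    by (auto intro!: measurable_If_set borel_measurable_times_ennreal kernel_op_measurable[OF K]
        simp: sp)
qed (use D in auto)

locale stationary_kernel =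
  fixes S :: "'a measure" and K :: "'a \<Rightarrow> 'a measure" and \<pi> :: "'a measure"
  assumes kernel: "K \<in> S \<rightarrow>\<^sub>M prob_algebra S"
    and space_UNIV: "space S = UNIV"
    and sets_\<pi>: "sets \<pi> = sets S"
    and prob_\<pi>: "prob_space \<pi>"
    and stationary: "\<And>g. g \<in> borel_measurable S \<Longrightarrow> (\<integral>\<^sup>+x. kernel_op K g x \<partial>\<pi>) = (\<integral>\<^sup>+x. g x \<partial>\<pi>)"
begin

lemma op_measurable [measurable]: "g \<in> borel_measurable S \<Longrightarrow> kernel_op K g \<in> borel_measurable S"
  by (rule kernel_op_measurable[OF kernel])

lemma op_pow_measurable [measurable]:
  "g \<in> borel_measurable S \<Longrightarrow> (kernel_op K ^^ N) g \<in> borel_measurable S"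
  by (induction N) auto

lemma kernel_prob: "prob_space (K x)" and kernel_sets: "sets (K x) = sets S"
  using measurable_space[OF kernel, of x] space_UNIV by (auto simp: space_prob_algebra)

lemma measurable_kernel: "g \<in> borel_measurable S \<Longrightarrow> g \<in> borel_measurable (K x)"
  using measurable_cong_sets[OF kernel_sets refl] by blast

lemma measurable_\<pi>: "g \<in> borel_measurable S \<Longrightarrow> g \<in> borel_measurable \<pi>"
  using measurable_cong_sets[OF sets_\<pi> refl] by blast

lemmas occupation_meas [measurable] = occupation_measurable[OF kernel space_UNIV]
lemmas reach_meas [measurable] = reach_measurable[OF kernel space_UNIV]

lemma occupation_finite:
  assumes "\<And>x. f x \<le> 1"
  shows "occupation K B f n x \<le> of_nat n"
proof (induction n arbitrary: x)
  case (Suc n)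
  have "kernel_op K (occupation K B f n) x \<le> (\<integral>\<^sup>+y. of_nat n \<partial>K x)"
    unfolding kernel_op_def by (intro nn_integral_mono Suc)
  also have "\<dots> = of_nat n"
    using prob_space.emeasure_space_1[OF kernel_prob, of x] by simp
  finally have "f x + kernel_op K (occupation K B f n) x \<le> 1 + of_nat n"
    using assms by (intro add_mono)
  then show ?case by (auto simp: indicator_def)
qed simp

text \<open>Kac's inequality for one step. Write \<open>U\<^sub>n\<close> for the truncated occupation. Integrating its recursion
  against the stationary law gives \<open>\<integral> U\<^sub>n\<^sub>+\<^sub>1 - \<integral> U\<^sub>n \<le> \<integral> f - \<integral>\<^sub>B K U\<^sub>n\<close>, where the left side is nonnegative
  because \<open>U\<^sub>n\<close> increases with \<open>n\<close>. The bound \<open>f \<le> 1\<close> makes \<open>\<integral> U\<^sub>n\<close> finite, so that it cancels.\<close>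
lemma occupation_after_visit_le:
  assumes [measurable]: "B \<in> sets S" "f \<in> borel_measurable S" and f1: "\<And>x. f x \<le> 1"
  shows "(\<integral>\<^sup>+x. indicator B x * kernel_op K (occupation K B f n) x \<partial>\<pi>) \<le> (\<integral>\<^sup>+x. f x \<partial>\<pi>)"
proof -
  let ?U = "occupation K B f"
  note [measurable_cong] = sets_\<pi>
  have sp: "space \<pi> = UNIV" using sets_eq_imp_space_eq[OF sets_\<pi>] space_UNIV by simp
  have fin: "(\<integral>\<^sup>+x. ?U n x \<partial>\<pi>) \<noteq> \<infinity>"
  proof -
    have "(\<integral>\<^sup>+x. ?U n x \<partial>\<pi>) \<le> (\<integral>\<^sup>+x. of_nat n \<partial>\<pi>)"
      by (intro nn_integral_mono occupation_finite f1)
    also have "\<dots> = of_nat n" using prob_space.emeasure_space_1[OF prob_\<pi>] by simp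
    finally show ?thesis by (auto simp: top_unique)
  qed
  have "(\<integral>\<^sup>+x. ?U n x \<partial>\<pi>) + (\<integral>\<^sup>+x. indicator B x * kernel_op K (?U n) x \<partial>\<pi>)
      \<le> (\<integral>\<^sup>+x. ?U (Suc n) x \<partial>\<pi>) + (\<integral>\<^sup>+x. indicator B x * kernel_op K (?U n) x \<partial>\<pi>)"
    by (intro add_right_mono nn_integral_mono occupation_mono)
  also have "\<dots> = (\<integral>\<^sup>+x. ?U (Suc n) x + indicator B x * kernel_op K (?U n) x \<partial>\<pi>)"
    by (subst nn_integral_add) auto
  also have "\<dots> \<le> (\<integral>\<^sup>+x. f x + kernel_op K (?U n) x \<partial>\<pi>)"
    by (intro nn_integral_mono) (auto simp: indicator_def)
  also have "\<dots> = (\<integral>\<^sup>+x. f x \<partial>\<pi>) + (\<integral>\<^sup>+x. ?U n x \<partial>\<pi>)"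
    by (subst nn_integral_add) (auto simp: stationary)
  finally show ?thesis
    using fin by (simp add: add.commute ennreal_add_left_cancel_le)
qed

lemma stationary_pow:
  assumes "g \<in> borel_measurable S"
  shows "(\<integral>\<^sup>+x. (kernel_op K ^^ N) g x \<partial>\<pi>) = (\<integral>\<^sup>+x. g x \<partial>\<pi>)"
  using assms by (induction N) (auto simp: stationary)

lemma op_pow_add:
  assumes "g \<in> borel_measurable S" "g' \<in> borel_measurable S"
  shows "(kernel_op K ^^ N) (\<lambda>y. g y + g' y) = (\<lambda>x. (kernel_op K ^^ N) g x + (kernel_op K ^^ N) g' x)"
proof (induction N)
  case (Suc N)
  have add: "kernel_op K (\<lambda>y. h y + h' y) x = kernel_op K h x + kernel_op K h' x"
    if "h \<in> borel_measurable S" "h' \<in> borel_measurable S" for h h' x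
    using that unfolding kernel_op_def by (intro nn_integral_add measurable_kernel)
  show ?case
    using assms by (simp add: Suc add)
qed simp

text \<open>When the chain is observed \<open>N\<close> steps after a visit to \<open>B\<close>, the excursion in progress began at the
  last visit to \<open>B\<close> among these \<open>N\<close> steps. Each of the \<open>N\<close> candidates contributes at most \<open>\<integral> f\<close> by the
  one-step inequality and stationarity. The number of steps stays free because refining the grid keeps
  the time \<open>h\<close> of a crossing fixed while the number of steps grows.\<close>
lemma occupation_after_steps_le:
  assumes [measurable]: "B \<in> sets S" "f \<in> borel_measurable S" and f1: "\<And>x. f x \<le> 1"
  shows "(\<integral>\<^sup>+x. indicator B x * (kernel_op K ^^ N) (occupation K B f n) x \<partial>\<pi>)
    \<le> of_nat N * (\<integral>\<^sup>+x. f x \<partial>\<pi>)"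
proof (induction N arbitrary: n)
  case 0
  have "(\<integral>\<^sup>+x. indicator B x * (kernel_op K ^^ 0) (occupation K B f n) x \<partial>\<pi>) = (\<integral>\<^sup>+x. 0 \<partial>\<pi>)"
    by (intro nn_integral_cong) (cases n; auto simp: indicator_def)
  then show ?case by simp
next
  case (Suc N)
  let ?U = "occupation K B f"
  note [measurable_cong] = sets_\<pi>
  let ?g = "\<lambda>x. indicator B x * kernel_op K (?U n) x"
  have meas: "?g \<in> borel_measurable S" by measurable
  have "(\<integral>\<^sup>+x. indicator B x * (kernel_op K ^^ Suc N) (?U n) x \<partial>\<pi>)
     \<le> (\<integral>\<^sup>+x. (kernel_op K ^^ N) ?g x + indicator B x * (kernel_op K ^^ N) (?U (Suc n)) x \<partial>\<pi>)"
  proof (rule nn_integral_mono)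
    fix x
    have "(kernel_op K ^^ Suc N) (?U n) x = (kernel_op K ^^ N) (kernel_op K (?U n)) x"
      by (simp add: funpow_swap1)
    \<comment> \<open>A step from \<open>B\<close> starts a new excursion; a step from outside \<open>B\<close> prolongs the present one.\<close>
    also have "\<dots> \<le> (kernel_op K ^^ N) (\<lambda>y. ?g y + ?U (Suc n) y) x"
      by (intro kernel_op_pow_mono) (auto simp: indicator_def)
    also have "\<dots> = (kernel_op K ^^ N) ?g x + (kernel_op K ^^ N) (?U (Suc n)) x"
      by (subst op_pow_add) (auto simp del: occupation.simps)
    finally show "indicator B x * (kernel_op K ^^ Suc N) (?U n) x
      \<le> (kernel_op K ^^ N) ?g x + indicator B x * (kernel_op K ^^ N) (?U (Suc n)) x"
      by (auto simp: indicator_def)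
  qed
  also have "\<dots> = (\<integral>\<^sup>+x. ?g x \<partial>\<pi>)
      + (\<integral>\<^sup>+x. indicator B x * (kernel_op K ^^ N) (?U (Suc n)) x \<partial>\<pi>)"
    using meas
    by (subst nn_integral_add) (auto simp: stationary_pow measurable_\<pi> simp del: occupation.simps)
  also have "\<dots> \<le> (\<integral>\<^sup>+x. f x \<partial>\<pi>) + of_nat N * (\<integral>\<^sup>+x. f x \<partial>\<pi>)"
    by (intro add_mono Suc occupation_after_visit_le f1 assms)
  finally show ?case by (simp add: distrib_right)
qed

text \<open>The two stages combine: a chain that reaches \<open>D\<close> before \<open>B\<close> collects at least \<open>u\<close> from there on.\<close>
lemma reach_le_occupation:
  assumes "B \<in> sets S" "D \<in> sets S"
    and u: "\<And>x. x \<in> D \<Longrightarrow> u \<le> occupation K B f n x"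
  shows "u * reach K B D m x \<le> occupation K B f (n + m) x"
proof (induction m arbitrary: x)
  case 0
  then show ?case using u by (auto simp: indicator_def)
next
  case (Suc m)
  show ?case
  proof (cases "x \<in> D")
    case True
    then show ?thesis using u[OF True] occupation_mono_le[of n "n + Suc m" K B f x] by simp
  next
    case False
    have "u * reach K B D (Suc m) x = indicator (- B) x * kernel_op K (\<lambda>y. u * reach K B D m y) x"
      using False assms by (subst kernel_op_cmult) (auto intro: measurable_kernel simp: ac_simps)
    also have "\<dots> \<le> indicator (- B) x * (f x + kernel_op K (occupation K B f (n + m)) x)"
      by (intro mult_left_mono add_increasing kernel_op_mono Suc) auto
    finally show ?thesis by simp
  qed
qed

end

section \<open>The Markov property at deterministic times\<close>

context cadlag_strong_Markov
begin

definition transition :: "real \<Rightarrow> 'x \<Rightarrow> 'x measure" where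
  "transition t x = distr (P x) borel (X t)"

lemma space_P: "space (P x) = space M"
  using sets_eq_imp_space_eq[OF sets_P] .

lemma F_sets: "0 \<le> t \<Longrightarrow> A \<in> sets (F t) \<Longrightarrow> A \<in> sets M"
  using subalg by (auto simp: subalgebra_def)

lemma F_space: "0 \<le> t \<Longrightarrow> space (F t) = space M"
  using subalg by (auto simp: subalgebra_def)

lemma X_measurable: "0 \<le> t \<Longrightarrow> X t \<in> M \<rightarrow>\<^sub>M borel"
  using adapted subalg measurable_from_subalg by blast

lemma X_measurable_P: "0 \<le> t \<Longrightarrow> X t \<in> P x \<rightarrow>\<^sub>M borel"
  using X_measurable measurable_cong_sets[OF sets_P refl] by blast

lemma X_event: "0 \<le> t \<Longrightarrow> B \<in> sets borel \<Longrightarrow> {\<omega> \<in> space M. X t \<omega> \<in> B} \<in> sets (F t)"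
  using measurable_sets[OF adapted, of t B] F_space[of t]
  by (simp add: vimage_def Int_def conj_commute)

lemma transition_kernel: "0 \<le> t \<Longrightarrow> transition t \<in> borel \<rightarrow>\<^sub>M prob_algebra borel"
  using kernel unfolding transition_def[abs_def] .

lemma transition_op:
  assumes "0 \<le> t" "g \<in> borel_measurable borel"
  shows "kernel_op (transition t) g x = (\<integral>\<^sup>+\<omega>. g (X t \<omega>) \<partial>P x)"
  unfolding kernel_op_def transition_def
  using assms by (intro nn_integral_distr X_measurable_P) auto

lemma transition_op_measurable:
  "0 \<le> t \<Longrightarrow> g \<in> borel_measurable borel \<Longrightarrow> kernel_op (transition t) g \<in> borel_measurable borel"
  by (rule kernel_op_measurable[OF transition_kernel])

lemma F_sets_sigma_at_const:
  assumes "0 \<le> s" "A \<in> sets (F s)"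
  shows "A \<in> sets (sigma_at M F (\<lambda>_. ennreal s))"
proof -
  define G where "G = {A \<in> sets M. \<forall>t\<ge>0. {\<omega> \<in> A. ennreal s \<le> ennreal t} \<in> sets (F t)}"
  have "{\<omega> \<in> A. ennreal s \<le> ennreal t} \<in> sets (F t)" if "0 \<le> t" for t
    using assms that filtration_mono[of s t] by (cases "s \<le> t") auto
  then have "A \<in> G" unfolding G_def using F_sets[OF assms] by blast
  moreover have "G \<subseteq> Pow (space M)"
    unfolding G_def by (blast dest: sets.sets_into_space)
  ultimately show ?thesis
    unfolding sigma_at_def G_def[symmetric] by (simp add: sets_measure_of)
qed

lemma sigma_at_subalgebra: "subalgebra (P x) (sigma_at M F \<tau>)"
proof -
  define G where "G = {A \<in> sets M. \<forall>t\<ge>0. {\<omega> \<in> A. \<tau> \<omega> \<le> ennreal t} \<in> sets (F t)}"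
  have "G \<subseteq> sets M" unfolding G_def by blast
  then have "sigma_sets (space M) G \<subseteq> sets M" "G \<subseteq> Pow (space M)"
    by (auto intro!: sets.sigma_sets_subset dest: sets.sets_into_space)
  then show ?thesis
    unfolding subalgebra_def sigma_at_def G_def[symmetric]
    by (simp add: sets_measure_of space_measure_of sets_P space_P)
qed

text \<open>The strong Markov property at the constant time \<open>s\<close>, in integrated form. Its \<open>\<sigma>\<close>-algebra is only
  needed through the inclusion \<open>F_sets_sigma_at_const\<close>.\<close>
lemma Markov_indicator:
  assumes s: "0 \<le> s" and t: "0 \<le> t" and A: "A \<in> sets (F s)" and B: "B \<in> sets borel"
  shows "(\<integral>\<^sup>+\<omega>. indicator A \<omega> * indicator B (X (s + t) \<omega>) \<partial>P x)
    = (\<integral>\<^sup>+\<omega>. indicator A \<omega> * emeasure (transition t (X s \<omega>)) B \<partial>P x)"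
proof -
  let ?G = "sigma_at M F (\<lambda>_. ennreal s)"
  let ?f = "\<lambda>\<omega>. indicator B (X (s + t) \<omega>) :: real"
  let ?k = "\<lambda>\<omega>. measure (transition t (X s \<omega>)) B"
  interpret prob_space "P x" by (rule prob)
  interpret finite_measure_subalgebra "P x" ?G
    by unfold_locales (rule sigma_at_subalgebra)
  have "random_stopping_time F (\<lambda>_. ennreal s)"
    unfolding random_stopping_time_def
  proof (intro allI impI)
    fix t :: real assume "0 \<le> t"
    then show "{\<omega> \<in> space (F t). ennreal s \<le> ennreal t} \<in> sets (F t)"
      by (cases "ennreal s \<le> ennreal t") auto
  qed
  from strong_Markov[OF this t B, of x]
  have eq: "AE \<omega> in P x. real_cond_exp (P x) ?G ?f \<omega> = ?k \<omega>"
  proof eventually_elim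
    case (elim \<omega>)
    have "measure (P (X s \<omega>)) {\<omega>' \<in> space M. X t \<omega>' \<in> B} = ?k \<omega>"
      unfolding transition_def using t B
      by (subst measure_distr) (auto intro!: X_measurable_P arg_cong[where f="measure _"] simp: space_P)
    with elim s show ?case by simp
  qed
  have AM: "A \<in> sets (P x)" using F_sets[OF s A] by (simp add: sets_P)
  have [measurable]: "X (s + t) \<in> P x \<rightarrow>\<^sub>M borel" "X s \<in> P x \<rightarrow>\<^sub>M borel"
    using s t by (auto intro: X_measurable_P)
  have [measurable]: "transition t \<in> borel \<rightarrow>\<^sub>M subprob_algebra borel"
    using transition_kernel[OF t] by (rule measurable_prob_algebraD)
  have km [measurable]: "?k \<in> borel_measurable (P x)"
    using B by measurable
  note [measurable] = B AM
  have tp: "prob_space (transition t y)" for y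
    unfolding transition_def
    by (rule prob_space.prob_space_distr[OF prob X_measurable_P[OF t]])
  have kb: "?k \<omega> \<le> 1" for \<omega> using prob_space.prob_le_1[OF tp] by simp
  have f_int: "integrable (P x) ?f"
    by (rule integrable_const_bound[where B=1]) (auto simp: indicator_def)
  have "(\<integral>\<omega>\<in>A. ?f \<omega> \<partial>P x) = (\<integral>\<omega>\<in>A. real_cond_exp (P x) ?G ?f \<omega> \<partial>P x)"
    by (rule real_cond_exp_intA[OF f_int F_sets_sigma_at_const[OF s A]])
  also have "\<dots> = (\<integral>\<omega>\<in>A. ?k \<omega> \<partial>P x)"
    using eq unfolding set_lebesgue_integral_def 
    by (intro integral_cong_AE) auto
  finally have *: "(\<integral>\<omega>. indicator A \<omega> * ?f \<omega> \<partial>P x) = (\<integral>\<omega>. indicator A \<omega> * ?k \<omega> \<partial>P x)"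
    by (simp add: set_lebesgue_integral_def)
  have "(\<integral>\<^sup>+\<omega>. ennreal (indicator A \<omega> * ?f \<omega>) \<partial>P x) = ennreal (\<integral>\<omega>. indicator A \<omega> * ?f \<omega> \<partial>P x)"
    by (intro nn_integral_eq_integral integrable_const_bound[where B=1]) (auto simp: indicator_def)
  also have "\<dots> = (\<integral>\<^sup>+\<omega>. ennreal (indicator A \<omega> * ?k \<omega>) \<partial>P x)"
    unfolding * using kb
    by (intro nn_integral_eq_integral[symmetric] integrable_const_bound[where B=1]) (auto simp: indicator_def)
  finally have "(\<integral>\<^sup>+\<omega>. ennreal (indicator A \<omega> * ?f \<omega>) \<partial>P x)
    = (\<integral>\<^sup>+\<omega>. ennreal (indicator A \<omega> * ?k \<omega>) \<partial>P x)" .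
  moreover have "ennreal (indicator A \<omega> * ?f \<omega>) = indicator A \<omega> * indicator B (X (s + t) \<omega>)" for \<omega>
    by (auto simp: indicator_def)
  moreover have "ennreal (indicator A \<omega> * ?k \<omega>) = indicator A \<omega> * emeasure (transition t (X s \<omega>)) B" for \<omega>
    using prob_space.finite_measure[OF tp]
    by (auto simp: indicator_def finite_measure.emeasure_eq_measure)
  ultimately show ?thesis by simp
qed

lemma Markov:
  assumes s: "0 \<le> s" and t: "0 \<le> t" and A: "A \<in> sets (F s)" and g: "g \<in> borel_measurable borel"
  shows "(\<integral>\<^sup>+\<omega>. indicator A \<omega> * g (X (s + t) \<omega>) \<partial>P x)
    = (\<integral>\<^sup>+\<omega>. indicator A \<omega> * kernel_op (transition t) g (X s \<omega>) \<partial>P x)"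
  using g
proof (induction rule: borel_measurable_induct)
  case (cong f g)
  then have fg: "f = g" by auto
  show ?case unfolding fg by (rule cong(4))
next
  case (set B)
  have "kernel_op (transition t) (indicator B) y = emeasure (transition t y) B" for y
    unfolding kernel_op_def using set by (intro nn_integral_indicator) (simp add: transition_def)
  with set show ?case by (simp add: Markov_indicator[OF s t A])
next
  note [measurable] = X_measurable_P[OF s] X_measurable_P[OF add_nonneg_nonneg[OF s t]]
    transition_op_measurable[OF t]
  have [measurable]: "A \<in> sets (P x)" using F_sets[OF s A] by (simp add: sets_P)
  have tm: "g \<in> borel_measurable (transition t y)" if "g \<in> borel_measurable borel" for g :: "'x \<Rightarrow> ennreal" and y
    using that by (simp add: transition_def)
  {
    case (mult u c)
    note [measurable] = mult.hyps
    have "kernel_op (transition t) (\<lambda>x. c * u x) y = c * kernel_op (transition t) u y" for y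
      using mult.hyps by (intro kernel_op_cmult tm) 
    moreover have "indicator A \<omega> * (c * z) = c * (indicator A \<omega> * z)" for \<omega> z
      by (simp only: ac_simps)
    ultimately show ?case
      using mult.IH by (simp add: nn_integral_cmult)
  next
    case (add u v)
    note [measurable] = add.hyps
    have "kernel_op (transition t) (\<lambda>x. v x + u x) y
      = kernel_op (transition t) v y + kernel_op (transition t) u y" for y
      unfolding kernel_op_def using add.hyps by (intro nn_integral_add tm) 
    then show ?case
      using add.IH by (simp add: distrib_left nn_integral_add)
  next
    case (seq U)
    note [measurable] = seq.hyps(1)
    have inc: "incseq (\<lambda>i. U i y)" for y
      using seq.hyps(3) by (auto simp: incseq_def le_fun_def)
    have *: "kernel_op (transition t) (SUP i. U i) y = (SUP i. kernel_op (transition t) (U i) y)" for y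
      unfolding kernel_op_def SUP_apply using seq.hyps
      by (intro nn_integral_monotone_convergence_SUP tm) auto
    have inc': "incseq (\<lambda>i. kernel_op (transition t) (U i) y)" for y
      using inc by (auto simp: incseq_def intro!: kernel_op_mono)
    have "(\<integral>\<^sup>+\<omega>. indicator A \<omega> * (SUP i. U i (X (s + t) \<omega>)) \<partial>P x)
      = (\<integral>\<^sup>+\<omega>. (SUP i. indicator A \<omega> * U i (X (s + t) \<omega>)) \<partial>P x)"
      by (simp add: SUP_mult_left_ennreal)
    also have "\<dots> = (SUP i. \<integral>\<^sup>+\<omega>. indicator A \<omega> * U i (X (s + t) \<omega>) \<partial>P x)"
      using inc by (intro nn_integral_monotone_convergence_SUP)
        (auto simp: incseq_def le_fun_def intro!: mult_left_mono)
    also have "\<dots> = (SUP i. \<integral>\<^sup>+\<omega>. indicator A \<omega> * kernel_op (transition t) (U i) (X s \<omega>) \<partial>P x)"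
      using seq.IH by simp
    also have "\<dots> = (\<integral>\<^sup>+\<omega>. (SUP i. indicator A \<omega> * kernel_op (transition t) (U i) (X s \<omega>)) \<partial>P x)"
      using inc' by (intro nn_integral_monotone_convergence_SUP[symmetric])
        (auto simp: incseq_def le_fun_def intro!: mult_left_mono)
    also have "\<dots> = (\<integral>\<^sup>+\<omega>. indicator A \<omega> * kernel_op (transition t) (SUP i. U i) (X s \<omega>) \<partial>P x)"
      by (simp add: SUP_mult_left_ennreal *)
    finally show ?case unfolding SUP_apply .
  }
qed

lemma start_AE: "AE \<omega> in P x. X 0 \<omega> = x"
proof -
  have "{\<omega> \<in> space M. X 0 \<omega> = x} \<in> sets M"
    using measurable_sets[OF X_measurable[of 0], of "{x}"] 
    by (simp add: vimage_def Int_def conj_commute)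
  then show ?thesis
    using start[of x] prob_space.prob_eq_1[OF prob, of "{\<omega> \<in> space M. X 0 \<omega> = x}" x]
    by (simp add: sets_P)
qed

lemma integral_at_start:
  assumes "g \<in> borel_measurable borel"
  shows "(\<integral>\<^sup>+\<omega>. g (X 0 \<omega>) \<partial>P x) = g x"
proof -
  have "(\<integral>\<^sup>+\<omega>. g (X 0 \<omega>) \<partial>P x) = (\<integral>\<^sup>+\<omega>. g x \<partial>P x)"
    using start_AE[of x] by (intro nn_integral_cong_AE) auto
  then show ?thesis using prob_space.emeasure_space_1[OF prob, of x] by simp
qed

lemma Chapman_Kolmogorov:
  assumes "0 \<le> s" "0 \<le> t" "g \<in> borel_measurable borel"
  shows "kernel_op (transition s) (kernel_op (transition t) g) x = kernel_op (transition (s + t)) g x"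
proof -
  have "space M \<in> sets (F s)" using sets.top[of "F s"] F_space[OF assms(1)] by simp
  from Markov[OF assms(1,2) this assms(3), of x]
  have "(\<integral>\<^sup>+\<omega>. g (X (s + t) \<omega>) \<partial>P x) = (\<integral>\<^sup>+\<omega>. kernel_op (transition t) g (X s \<omega>) \<partial>P x)"
    by (simp add: space_P[symmetric, of x] cong: nn_integral_cong_simp)
  then show ?thesis
    using assms by (simp add: transition_op transition_op_measurable)
qed

text \<open>\<open>N\<close> steps of the grid chain with mesh \<open>d\<close> are one transition over time \<open>N d\<close>, on every grid alike.
  This lets the crossing time stay fixed under refinement.\<close>
lemma transition_op_pow:
  assumes "0 \<le> d" "g \<in> borel_measurable borel"
  shows "(kernel_op (transition d) ^^ N) g x = kernel_op (transition (real N * d)) g x"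
proof (induction N arbitrary: x)
  case 0
  then show ?case using assms by (simp add: transition_op integral_at_start)
next
  case (Suc N)
  have "(kernel_op (transition d) ^^ N) g = kernel_op (transition (real N * d)) g"
    using Suc by auto
  then show ?case
    using assms by (simp add: Chapman_Kolmogorov algebra_simps)
qed

text \<open>Invariance is given for bounded real functions. Testing it on indicators identifies the measures
  \<open>\<pi> \<bind> transition t\<close> and \<open>\<pi>\<close>, hence it extends to all functions with values in \<open>[0, \<infinity>]\<close>.\<close>
lemma transition_stationary:
  assumes inv: "invariant_prob P X \<pi>" and t: "0 \<le> t"
  shows "stationary_kernel borel (transition t) \<pi>"
proof (rule stationary_kernel.intro)
  show "transition t \<in> borel \<rightarrow>\<^sub>M prob_algebra borel" by (rule transition_kernel[OF t])
  show "prob_space \<pi>" "sets \<pi> = sets borel" using inv by (auto simp: invariant_prob_def)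
  interpret pi: prob_space \<pi> by fact
  note inv' = conjunct2[OF conjunct2[OF inv[unfolded invariant_prob_def]], rule_format]
  note sp = \<open>sets \<pi> = sets borel\<close>
  have "\<pi> \<bind> transition t = \<pi>"
  proof (rule measure_eqI)
    have sb: "transition t \<in> \<pi> \<rightarrow>\<^sub>M subprob_algebra borel"
      using measurable_prob_algebraD[OF transition_kernel[OF t]] measurable_cong_sets[OF sp refl] by blast
    have ne: "space \<pi> \<noteq> {}" by (rule pi.not_empty)
    show "sets (\<pi> \<bind> transition t) = sets \<pi>"
      using sets_bind[OF _ ne, of "transition t" borel] sp by (simp add: transition_def)
    fix B assume "B \<in> sets (\<pi> \<bind> transition t)"
    then have B: "B \<in> sets borel"
      using sets_bind[OF _ ne, of "transition t" borel] by (simp add: transition_def)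
    have m: "(\<integral>\<omega>. indicator B (X t \<omega>) \<partial>P x) = measure (transition t x) B" for x
    proof -
      have "measure (transition t x) B = measure (P x) {\<omega> \<in> space (P x). X t \<omega> \<in> B}"
        unfolding transition_def using t B
        by (subst measure_distr) (auto intro!: X_measurable_P arg_cong[where f="measure _"])
      also have "\<dots> = (\<integral>\<omega>. indicator {\<omega> \<in> space (P x). X t \<omega> \<in> B} \<omega> \<partial>P x)"
        by (simp add: Int_def conj_commute)
      also have "\<dots> = (\<integral>\<omega>. indicator B (X t \<omega>) \<partial>P x)"
        by (intro Bochner_Integration.integral_cong) (auto simp: indicator_def)
      finally show ?thesis by simp
    qed
    have tp: "prob_space (transition t y)" for y
      unfolding transition_def
      by (rule prob_space.prob_space_distr[OF prob X_measurable_P[OF t]])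
    have mk: "(\<lambda>x. measure (transition t x) B) \<in> borel_measurable \<pi>"
      using B sb by measurable
    have "(\<integral>x. (\<integral>\<omega>. indicator B (X t \<omega>) \<partial>P x) \<partial>\<pi>) = (\<integral>x. (indicator B x :: real) \<partial>\<pi>)"
    proof -
      have b: "bounded (range (indicator B :: 'x \<Rightarrow> real))"
        by (auto simp: indicator_def bounded_iff intro!: exI[of _ 1])
      have m: "(indicator B :: 'x \<Rightarrow> real) \<in> borel_measurable borel" using B by simp
      show ?thesis
        by (rule inv'[OF m _ b t]) simp
    qed
    then have *: "(\<integral>x. measure (transition t x) B \<partial>\<pi>) = measure \<pi> B"
      using B sp by (simp add: m)
    have "emeasure (\<pi> \<bind> transition t) B = (\<integral>\<^sup>+x. emeasure (transition t x) B \<partial>\<pi>)"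
      by (rule emeasure_bind[OF ne sb B])
    also have "\<dots> = (\<integral>\<^sup>+x. ennreal (measure (transition t x) B) \<partial>\<pi>)"
      by (simp add: finite_measure.emeasure_eq_measure[OF prob_space.finite_measure[OF tp]])
    also have "\<dots> = ennreal (\<integral>x. measure (transition t x) B \<partial>\<pi>)"
      by (intro nn_integral_eq_integral pi.integrable_const_bound[where B=1] mk)
        (auto simp: prob_space.prob_le_1[OF tp])
    finally show "emeasure (\<pi> \<bind> transition t) B = emeasure \<pi> B"
      by (simp add: * pi.emeasure_eq_measure)
  qed
  then show "(\<integral>\<^sup>+x. kernel_op (transition t) g x \<partial>\<pi>) = (\<integral>\<^sup>+x. g x \<partial>\<pi>)"
    if "g \<in> borel_measurable borel" for g
    using nn_integral_bind[OF that, of "transition t" \<pi>]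
      measurable_prob_algebraD[OF transition_kernel[OF t]] measurable_cong_sets[OF sp refl]
    unfolding kernel_op_def by metis
qed simp

end

section \<open>Excursion events on a time grid\<close>

context cadlag_strong_Markov
begin

text \<open>Induction over the number of steps, with the Markov property applied at the first grid point. The
  past event \<open>A\<close> and the starting time \<open>s\<close> vary, since the step passes to \<open>s + d\<close> and to a smaller event.\<close>
lemma emeasure_reach_le:
  assumes d: "0 \<le> d" and s: "0 \<le> s" and A: "A \<in> sets (F s)"
    and B: "B \<in> sets borel" and D: "D \<in> sets borel"
  shows "emeasure (P x) (A \<inter> {\<omega> \<in> space M. \<exists>k\<le>m. X (s + real k * d) \<omega> \<in> D \<and>
      (\<forall>j<k. X (s + real j * d) \<omega> \<notin> B)})
    \<le> (\<integral>\<^sup>+\<omega>. indicator A \<omega> * reach (transition d) B D m (X s \<omega>) \<partial>P x)"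
  using s A
proof (induction m arbitrary: s A)
  case 0
  have Xs [measurable]: "X s \<in> P x \<rightarrow>\<^sub>M borel" using 0 by (intro X_measurable_P)
  have [measurable]: "A \<in> sets (P x)" using F_sets[OF 0] by (simp add: sets_P)
  note [measurable] = D
  have "emeasure (P x) (A \<inter> {\<omega> \<in> space M. X s \<omega> \<in> D})
    = (\<integral>\<^sup>+\<omega>. indicator (A \<inter> {\<omega> \<in> space (P x). X s \<omega> \<in> D}) \<omega> \<partial>P x)"
  proof -
    have "A \<inter> {\<omega> \<in> space (P x). X s \<omega> \<in> D} \<in> sets (P x)" by measurable
    then show ?thesis by (simp add: space_P)
  qed
  also have "\<dots> = (\<integral>\<^sup>+\<omega>. indicator A \<omega> * indicator D (X s \<omega>) \<partial>P x)"
    by (intro nn_integral_cong) (auto simp: indicator_def)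
  finally show ?case by simp
next
  case (Suc m)
  note spP = space_P[of x]
  define E where "E s m = {\<omega> \<in> space M. \<exists>k\<le>m. X (s + real k * d) \<omega> \<in> D \<and>
      (\<forall>j<k. X (s + real j * d) \<omega> \<notin> B)}" for s :: real and m :: nat
  let ?R = "reach (transition d) B D"
  have sd: "0 \<le> s + d" using d Suc.prems by simp
  have R [measurable]: "?R m \<in> borel_measurable borel" for m
    using B D by (intro reach_measurable[OF transition_kernel[OF d]]) auto
  define A1 where "A1 = A \<inter> {\<omega> \<in> space M. X s \<omega> \<in> D}"
  define A2 where "A2 = A \<inter> {\<omega> \<in> space M. X s \<omega> \<in> - (D \<union> B)}"
  have A1F: "A1 \<in> sets (F s)" and A2F: "A2 \<in> sets (F s)"
    unfolding A1_def A2_def using Suc.prems B D by (intro sets.Int X_event; auto)+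
  have A2F': "A2 \<in> sets (F (s + d))"
    using A2F filtration_mono[of s "s + d"] d Suc.prems by auto
  have AP [measurable]: "A \<in> sets (P x)" "A1 \<in> sets (P x)" "A2 \<in> sets (P x)"
    using F_sets[OF Suc.prems] F_sets[OF Suc.prems(1) A1F] F_sets[OF Suc.prems(1) A2F]
    by (auto simp: sets_P)
  have XmM: "X (s + d + real k * d) \<in> M \<rightarrow>\<^sub>M borel" for k
    using d sd by (intro X_measurable) auto
  have EM: "E (s + d) m \<in> sets M"
  proof -
    note [measurable] = XmM B D
    show ?thesis unfolding E_def by measurable
  qed
  then have EP: "E (s + d) m \<in> sets (P x)" by (simp add: sets_P)
  have Xs [measurable]: "X s \<in> P x \<rightarrow>\<^sub>M borel" using Suc.prems by (intro X_measurable_P)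
  note [measurable] = transition_op_measurable[OF d]
  have "A \<inter> E s (Suc m) \<subseteq> A1 \<union> (A2 \<inter> E (s + d) m)"
  proof
    fix \<omega> assume \<omega>: "\<omega> \<in> A \<inter> E s (Suc m)"
    then obtain k where k: "k \<le> Suc m" "X (s + real k * d) \<omega> \<in> D"
      "\<forall>j<k. X (s + real j * d) \<omega> \<notin> B" and "\<omega> \<in> space M" "\<omega> \<in> A"
      unfolding E_def by blast
    show "\<omega> \<in> A1 \<union> (A2 \<inter> E (s + d) m)"
    proof (cases "X s \<omega> \<in> D")
      case True then show ?thesis using \<omega> by (auto simp: A1_def E_def)
    next
      case False
      then obtain k' where k': "k = Suc k'" using k(2) by (cases k) auto
      have "X s \<omega> \<notin> B" using k(3) k' by force
      moreover have "\<forall>j<k'. X (s + d + real j * d) \<omega> \<notin> B"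
      proof (intro allI impI)
        fix j assume "j < k'"
        with k(3) k' have "X (s + real (Suc j) * d) \<omega> \<notin> B" by blast
        then show "X (s + d + real j * d) \<omega> \<notin> B" by (simp add: algebra_simps)
      qed
      moreover have "X (s + d + real k' * d) \<omega> \<in> D" using k(2) k' by (simp add: algebra_simps)
      ultimately show ?thesis
        using False k(1) k' \<open>\<omega> \<in> space M\<close> \<open>\<omega> \<in> A\<close> by (auto simp: A2_def E_def)
    qed
  qed
  then have "emeasure (P x) (A \<inter> E s (Suc m)) \<le> emeasure (P x) (A1 \<union> (A2 \<inter> E (s + d) m))"
    by (rule emeasure_mono) (intro sets.Un sets.Int AP EP)+
  also have "\<dots> \<le> emeasure (P x) A1 + emeasure (P x) (A2 \<inter> E (s + d) m)"
    by (rule emeasure_subadditive) (intro sets.Int AP EP)+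
  also have "\<dots> \<le> (\<integral>\<^sup>+\<omega>. indicator A1 \<omega> \<partial>P x) + (\<integral>\<^sup>+\<omega>. indicator A2 \<omega> * ?R m (X (s + d) \<omega>) \<partial>P x)"
    using Suc.IH[OF sd A2F'] by (intro add_mono) (auto simp: E_def)
  also have "\<dots> = (\<integral>\<^sup>+\<omega>. indicator A1 \<omega> \<partial>P x)
      + (\<integral>\<^sup>+\<omega>. indicator A2 \<omega> * kernel_op (transition d) (?R m) (X s \<omega>) \<partial>P x)"
    by (subst Markov[OF Suc.prems(1) d A2F R]) simp
  also have "\<dots> = (\<integral>\<^sup>+\<omega>. indicator A1 \<omega>
      + indicator A2 \<omega> * kernel_op (transition d) (?R m) (X s \<omega>) \<partial>P x)"
    using R[of m] by (subst nn_integral_add) auto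
  also have "\<dots> \<le> (\<integral>\<^sup>+\<omega>. indicator A \<omega> * ?R (Suc m) (X s \<omega>) \<partial>P x)"
    by (intro nn_integral_mono) (auto simp: A1_def A2_def indicator_def)
  finally show ?case by (simp add: E_def)
qed

text \<open>If the chain is in \<open>C\<close> at the first \<open>n\<close> grid points, then all \<open>n\<close> of them count before \<open>B\<close> is visited.
  The induction is the same as for \<open>emeasure_reach_le\<close>.\<close>
lemma emeasure_stay_le:
  assumes d: "0 \<le> d" and s: "0 \<le> s" and A: "A \<in> sets (F s)"
    and B: "B \<in> sets borel" and C: "C \<in> sets borel" "C \<inter> B = {}"
  shows "of_nat n * emeasure (P x) (A \<inter> {\<omega> \<in> space M. \<forall>j<n. X (s + real j * d) \<omega> \<in> C})
    \<le> (\<integral>\<^sup>+\<omega>. indicator A \<omega> * occupation (transition d) B (indicator C) n (X s \<omega>) \<partial>P x)"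
  using s A
proof (induction n arbitrary: s A)
  case (Suc n)
  define E where "E s n = {\<omega> \<in> space M. \<forall>j<n. X (s + real j * d) \<omega> \<in> C}" for s :: real and n :: nat
  let ?U = "occupation (transition d) B (indicator C)"
  have sd: "0 \<le> s + d" using d Suc.prems by simp
  have U [measurable]: "?U n \<in> borel_measurable borel" for n
    using B C(1) by (intro occupation_measurable[OF transition_kernel[OF d]]) auto
  define A1 where "A1 = A \<inter> {\<omega> \<in> space M. X s \<omega> \<in> C}"
  have A1F: "A1 \<in> sets (F s)"
    unfolding A1_def using Suc.prems C by (intro sets.Int X_event; auto)
  have A1F': "A1 \<in> sets (F (s + d))"
    using A1F filtration_mono[of s "s + d"] d Suc.prems by auto
  have [measurable]: "A \<in> sets (P x)" "A1 \<in> sets (P x)"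
    using F_sets[OF Suc.prems] F_sets[OF Suc.prems(1) A1F] by (auto simp: sets_P)
  have Xs [measurable]: "X s \<in> P x \<rightarrow>\<^sub>M borel" using Suc.prems by (intro X_measurable_P)
  note [measurable] = transition_op_measurable[OF d]
  have eq: "A \<inter> E s (Suc n) = A1 \<inter> E (s + d) n"
    unfolding E_def A1_def by (auto simp: All_less_Suc2 algebra_simps)
  have "of_nat (Suc n) * emeasure (P x) (A \<inter> E s (Suc n))
    = emeasure (P x) (A1 \<inter> E (s + d) n) + of_nat n * emeasure (P x) (A1 \<inter> E (s + d) n)"
    by (simp add: eq distrib_right)
  also have "\<dots> \<le> emeasure (P x) A1 + (\<integral>\<^sup>+\<omega>. indicator A1 \<omega> * ?U n (X (s + d) \<omega>) \<partial>P x)"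
    using Suc.IH[OF sd A1F'] by (intro add_mono emeasure_mono) (auto simp: E_def)
  also have "\<dots> = (\<integral>\<^sup>+\<omega>. indicator A1 \<omega> \<partial>P x)
      + (\<integral>\<^sup>+\<omega>. indicator A1 \<omega> * kernel_op (transition d) (?U n) (X s \<omega>) \<partial>P x)"
    by (subst Markov[OF Suc.prems(1) d A1F U]) simp
  also have "\<dots> = (\<integral>\<^sup>+\<omega>. indicator A1 \<omega>
      + indicator A1 \<omega> * kernel_op (transition d) (?U n) (X s \<omega>) \<partial>P x)"
    using U[of n] by (subst nn_integral_add) auto
  also have "\<dots> \<le> (\<integral>\<^sup>+\<omega>. indicator A \<omega> * ?U (Suc n) (X s \<omega>) \<partial>P x)"
    using C(2) by (intro nn_integral_mono) (auto simp: A1_def indicator_def)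
  finally show ?case by (simp add: E_def)
qed simp

end

section \<open>Grids and right-continuous paths\<close>

lemma dyadic_grid_eventually_between:
  fixes a b d :: real
  assumes "0 \<le> a" "a < b" "0 < d"
  shows "\<forall>\<^sub>F n in sequentially. \<exists>k. a < real k * (d / 2 ^ n) \<and> real k * (d / 2 ^ n) < b"
proof -
  have "(\<lambda>n. d * (1 / 2) ^ n) \<longlonglongrightarrow> 0"
    by (intro tendsto_mult_right_zero LIMSEQ_power_zero) auto
  from order_tendstoD(2)[OF this, of "b - a"] assms
  have "\<forall>\<^sub>F n in sequentially. d * (1 / 2) ^ n < b - a" by simp
  then show ?thesis
  proof eventually_elim
    case (elim n)
    define e where "e = d / 2 ^ n"
    have e: "0 < e" "e < b - a" using elim assms by (auto simp: e_def power_divide)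
    define k where "k = nat (\<lfloor>a / e\<rfloor> + 1)"
    have k: "real k = of_int \<lfloor>a / e\<rfloor> + 1"
      unfolding k_def using assms e by (simp add: of_nat_nat)
    have "a / e < real k" "real k \<le> a / e + 1" unfolding k by linarith+
    then have "a < real k * e" "real k * e \<le> a + e" using e by (auto simp: field_simps)
    then show ?case using e by (intro exI[of _ k]) (auto simp: e_def)
  qed
qed

text \<open>Here \<open>I\<close> is the accumulated drift of a path and \<open>a\<close> its height. The sum is \<open>I\<close> stopped at the first
  grid point where \<open>a < r\<close>. Between grid points the path may drop below \<open>r\<close>, where only the crude slope
  bound \<open>c\<close> holds; but a right-continuous path that drops below \<open>r\<close> stays there for a while, so a fine
  grid detects the exit soon after it happens, and the excess over the slope \<open>c1\<close> disappears in the limit.\<close>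
lemma stopped_grid_sum_le:
  fixes a I :: "real \<Rightarrow> real"
  assumes right: "\<And>t. 0 \<le> t \<Longrightarrow> (a \<longlongrightarrow> a t) (at_right t)"
    and I0: "I 0 = 0"
    and mono: "\<And>s t. 0 \<le> s \<Longrightarrow> s \<le> t \<Longrightarrow> I s \<le> I t"
    and lip: "\<And>s t. 0 \<le> s \<Longrightarrow> s \<le> t \<Longrightarrow> I t - I s \<le> c * (t - s)"
    and small: "\<And>s. 0 \<le> s \<Longrightarrow> (\<And>u. 0 \<le> u \<Longrightarrow> u < s \<Longrightarrow> r \<le> a u) \<Longrightarrow> I s \<le> c1 * s"
    and "0 < d" "0 \<le> c1" "0 \<le> c" "0 < e"
  shows "\<forall>\<^sub>F i in sequentially.
    (\<Sum>k<n * 2 ^ i. if \<forall>j\<le>k. r \<le> a (real j * (d / 2 ^ i))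
       then I (real (Suc k) * (d / 2 ^ i)) - I (real k * (d / 2 ^ i)) else 0)
      \<le> c1 * (real n * d) + e"
proof -
  let ?J = "\<lambda>i. \<Sum>k<n * 2 ^ i. if \<forall>j\<le>k. r \<le> a (real j * (d / 2 ^ i))
       then I (real (Suc k) * (d / 2 ^ i)) - I (real k * (d / 2 ^ i)) else 0"
  have J: "?J i \<le> I (real (min p (n * 2 ^ i)) * (d / 2 ^ i))"
    if p: "\<And>k. p \<le> k \<Longrightarrow> k < n * 2 ^ i \<Longrightarrow> \<not> (\<forall>j\<le>k. r \<le> a (real j * (d / 2 ^ i)))" for i p
  proof -
    have "?J i = (\<Sum>k<min p (n * 2 ^ i). if \<forall>j\<le>k. r \<le> a (real j * (d / 2 ^ i))
       then I (real (Suc k) * (d / 2 ^ i)) - I (real k * (d / 2 ^ i)) else 0)"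
    proof (intro sum.mono_neutral_right ballI)
      fix k assume "k \<in> {..<n * 2 ^ i} - {..<min p (n * 2 ^ i)}"
      then have "p \<le> k" "k < n * 2 ^ i" by auto
      from p[OF this] show "(if \<forall>j\<le>k. r \<le> a (real j * (d / 2 ^ i))
        then I (real (Suc k) * (d / 2 ^ i)) - I (real k * (d / 2 ^ i)) else 0) = 0"
        by (rule if_not_P)
    qed auto
    also have "\<dots> \<le> (\<Sum>k<min p (n * 2 ^ i). I (real (Suc k) * (d / 2 ^ i)) - I (real k * (d / 2 ^ i)))"
      using \<open>0 < d\<close> by (intro sum_mono) (auto intro!: mono mult_right_mono divide_right_mono)
    also have "\<dots> = I (real (min p (n * 2 ^ i)) * (d / 2 ^ i))"
      using sum_lessThan_telescope[of "\<lambda>k. I (real k * (d / 2 ^ i))" "min p (n * 2 ^ i)"] I0 by simp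
    finally show ?thesis .
  qed
  show ?thesis
  proof (cases "\<forall>u. 0 \<le> u \<longrightarrow> u < real n * d \<longrightarrow> r \<le> a u")
    case True
    have "?J i \<le> c1 * (real n * d) + e" for i
    proof -
      have "?J i \<le> I (real (min (n * 2 ^ i) (n * 2 ^ i)) * (d / 2 ^ i))"
        by (rule J) auto
      also have "\<dots> \<le> c1 * (real n * d)"
        using True \<open>0 < d\<close> by (simp, intro small) auto
      finally show ?thesis using \<open>0 < e\<close> by simp
    qed
    then show ?thesis by simp
  next
    case False
    define Z where "Z = {u. 0 \<le> u \<and> a u < r}"
    define \<tau> where "\<tau> = Inf Z"
    obtain u0 where u0: "u0 \<in> Z" "u0 < real n * d" using False by (force simp: Z_def)
    have bdd: "bdd_below Z" by (rule bdd_belowI[of _ 0]) (auto simp: Z_def)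
    have \<tau>: "0 \<le> \<tau>" "\<tau> < real n * d"
      unfolding \<tau>_def using u0 bdd cInf_lower[OF u0(1) bdd]
      by (auto intro!: cInf_greatest simp: Z_def)
    have before: "r \<le> a u" if "0 \<le> u" "u < \<tau>" for u
      using cInf_lower[of u Z] bdd that unfolding \<tau>_def by (force simp: Z_def)
    have I\<tau>: "I \<tau> \<le> c1 * \<tau>" using \<tau> before by (intro small) auto
    \<comment> \<open>A delay of \<open>\<eta>\<close> after the exit time \<open>\<tau>\<close> costs at most \<open>c \<eta> \<le> e\<close>; the summand \<open>1\<close> covers \<open>c = 0\<close>.\<close>
    define \<eta> where "\<eta> = e / (c + 1)"
    have \<eta>: "0 < \<eta>" "c * \<eta> \<le> e" using \<open>0 < e\<close> \<open>0 \<le> c\<close> by (auto simp: \<eta>_def field_simps)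
    obtain v where v: "v \<in> Z" "v < \<tau> + \<eta>"
      using cInf_lessD[of Z "\<tau> + \<eta>"] u0 \<eta> unfolding \<tau>_def by auto
    have "\<forall>\<^sub>F u in at_right v. a u < r"
      using right[of v] v by (intro order_tendstoD(2)[where a=r]) (auto simp: Z_def)
    then obtain v' where v': "v < v'" "\<And>u. v < u \<Longrightarrow> u < v' \<Longrightarrow> a u < r"
      unfolding eventually_at_right_field by auto
    have "\<forall>\<^sub>F i in sequentially. \<exists>p. v < real p * (d / 2 ^ i) \<and> real p * (d / 2 ^ i) < min v' (\<tau> + \<eta>)"
      using v v' \<open>0 < d\<close> by (intro dyadic_grid_eventually_between) (auto simp: Z_def)
    then show ?thesis
    proof eventually_elim
      case (elim i)
      then obtain p where p: "v < real p * (d / 2 ^ i)" "real p * (d / 2 ^ i) < v'"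
        "real p * (d / 2 ^ i) < \<tau> + \<eta>" by auto
      define s where "s = real (min p (n * 2 ^ i)) * (d / 2 ^ i)"
      have "s \<le> real p * (d / 2 ^ i)"
        unfolding s_def using \<open>0 < d\<close> by (intro mult_right_mono) auto
      then have s: "0 \<le> s" "s < \<tau> + \<eta>" using p \<open>0 < d\<close> by (auto simp: s_def)
      have "a (real p * (d / 2 ^ i)) < r" using p v' by auto
      then have "?J i \<le> I s"
        unfolding s_def by (intro J) (auto simp: not_le)
      also have "I s \<le> c1 * \<tau> + e"
      proof (cases "s \<le> \<tau>")
        case True
        then show ?thesis using mono[OF s(1) True] I\<tau> \<open>0 < e\<close> by linarith
      next
        case False
        then have "I s - I \<tau> \<le> c * (s - \<tau>)" using \<tau> by (intro lip) auto
        also have "\<dots> \<le> c * \<eta>" using s \<open>0 \<le> c\<close> by (intro mult_left_mono) auto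
        finally show ?thesis using I\<tau> \<eta> by linarith
      qed
      also have "\<dots> \<le> c1 * (real n * d) + e"
        using \<tau> \<open>0 \<le> c1\<close> by (intro add_right_mono mult_left_mono) auto
      finally show ?case .
    qed
  qed
qed

text \<open>The path is the limit of its values at the next dyadic point strictly to the right.\<close>
lemma right_continuous_measurable:
  fixes w :: "real \<Rightarrow> real"
  assumes "\<And>t. 0 \<le> t \<Longrightarrow> (w \<longlongrightarrow> w t) (at_right t)"
  shows "(\<lambda>u. indicator {0..} u * w u) \<in> borel_measurable borel"
proof (rule borel_measurable_LIMSEQ_real)
  fix i :: nat
  have "(\<lambda>k::int. w ((of_int k + 1) / 2 ^ i)) \<in> borel_measurable (count_space UNIV)" by simp
  moreover have "(\<lambda>u::real. \<lfloor>(2::real) ^ i * u\<rfloor>) \<in> borel \<rightarrow>\<^sub>M count_space UNIV" by measurable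
  ultimately have [measurable]: "(\<lambda>u::real. w ((of_int \<lfloor>(2::real) ^ i * u\<rfloor> + 1) / 2 ^ i)) \<in> borel_measurable borel"
    by (rule measurable_compose[rotated])
  show "(\<lambda>u. indicator {0..} u * w ((of_int \<lfloor>(2::real) ^ i * u\<rfloor> + 1) / 2 ^ i)) \<in> borel_measurable borel"
    by measurable
next
  fix u :: real
  show "(\<lambda>i. indicator {0..} u * w ((of_int \<lfloor>(2::real) ^ i * u\<rfloor> + 1) / 2 ^ i)) \<longlonglongrightarrow> indicator {0..} u * w u"
  proof (cases "0 \<le> u")
    case True
    let ?g = "\<lambda>i::nat. (of_int \<lfloor>(2::real) ^ i * u\<rfloor> + 1) / 2 ^ i :: real"
    have gt: "u < ?g i" and le: "?g i \<le> u + (1 / 2) ^ i" for i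
    proof -
      have "2 ^ i * u < of_int \<lfloor>(2::real) ^ i * u\<rfloor> + 1" "of_int \<lfloor>(2::real) ^ i * u\<rfloor> + 1 \<le> 2 ^ i * u + 1" by linarith+
      then show "u < ?g i" "?g i \<le> u + (1 / 2) ^ i" by (auto simp: field_simps power_divide)
    qed
    have "(\<lambda>i. u + (1 / 2) ^ i) \<longlonglongrightarrow> u + 0"
      by (intro tendsto_add tendsto_const LIMSEQ_power_zero) auto
    then have "?g \<longlonglongrightarrow> u"
      using gt le by (intro tendsto_sandwich[of "\<lambda>_. u" ?g _ "\<lambda>i. u + (1 / 2) ^ i"])
        (auto intro!: always_eventually less_imp_le)
    then have "filterlim ?g (at_right u) sequentially"
      unfolding filterlim_at using gt by (simp add: less_imp_neq[THEN not_sym])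
    from filterlim_compose[OF assms[OF True] this] True show ?thesis by simp
  qed simp
qed

section \<open>Staying above a high level\<close>

text \<open>The properties of the drift integral that \<open>stopped_grid_sum_le\<close> asks for. The rate bound \<open>c1\<close> is
  required strictly before \<open>s\<close> only, because at the exit time itself the path may already be low.\<close>
lemma primitive_of_bounded:
  fixes g :: "real \<Rightarrow> real"
  assumes meas: "(\<lambda>u. indicator {0..} u * g u) \<in> borel_measurable borel"
    and bounds: "\<And>u. 0 \<le> u \<Longrightarrow> 0 \<le> g u" "\<And>u. 0 \<le> u \<Longrightarrow> g u \<le> c"
  shows primitive_integrable: "\<And>t. set_integrable lborel {0..t} g"
    and primitive_0: "(LBINT u:{0..0}. g u) = 0"
    and primitive_mono: "\<And>s t. 0 \<le> s \<Longrightarrow> s \<le> t \<Longrightarrow> (LBINT u:{0..s}. g u) \<le> (LBINT u:{0..t}. g u)"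
    and primitive_lipschitz: "\<And>s t. 0 \<le> s \<Longrightarrow> s \<le> t \<Longrightarrow>
      (LBINT u:{0..t}. g u) - (LBINT u:{0..s}. g u) \<le> c * (t - s)"
    and primitive_le: "\<And>s c1. 0 \<le> s \<Longrightarrow> (\<And>u. 0 \<le> u \<Longrightarrow> u < s \<Longrightarrow> g u \<le> c1) \<Longrightarrow>
      (LBINT u:{0..s}. g u) \<le> c1 * s"
proof -
  show int: "set_integrable lborel {0..t} g" for t
  proof -
    have "integrable lborel (\<lambda>u. indicator {0..t} u *\<^sub>R (indicator {0..} u * g u))"
    proof (rule integrableI_bounded_set_indicator[where B=c])
      show "AE u in lborel. u \<in> {0..t} \<longrightarrow> norm (indicator {0..} u * g u) \<le> c"
        using bounds by (intro AE_I2) (auto simp: indicator_def)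
    qed (use meas in \<open>auto simp: emeasure_lborel_Icc_eq\<close>)
    moreover have "(\<lambda>u. indicator {0..t} u *\<^sub>R (indicator {0..} u * g u)) = (\<lambda>u. indicator {0..t} u *\<^sub>R g u)"
      by (auto simp: indicator_def fun_eq_iff)
    ultimately show ?thesis unfolding set_integrable_def by (simp only:)
  qed
  have const: "integrable lborel (\<lambda>u. indicator {s..t} u *\<^sub>R (k::real))" for s t k :: real
    by (intro integrableI_bounded_set_indicator[where B="\<bar>k\<bar>"]) (auto simp: emeasure_lborel_Icc_eq)
  have cI: "(\<integral>u. indicator {s..t} u *\<^sub>R (k::real) \<partial>lborel) = k * (t - s)" if "s \<le> t" for s t k
    using that by (simp add: measure_lborel_Icc)
  show "(LBINT u:{0..0}. g u) = 0"
  proof -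
    have "(LBINT u:{0..0}. g u) = (\<integral>u. 0 \<partial>(lborel :: real measure))"
      unfolding set_lebesgue_integral_def
    proof (rule integral_cong_AE)
      show "AE u in lborel. indicator {0..0} u *\<^sub>R g u = 0"
        using AE_lborel_singleton[of "0::real"] by eventually_elim (auto simp: indicator_def)
    qed (use int[of 0] in \<open>auto simp: set_integrable_def\<close>)
    then show ?thesis by simp
  qed
  show "(LBINT u:{0..s}. g u) \<le> (LBINT u:{0..t}. g u)" if "0 \<le> s" "s \<le> t" for s t
    unfolding set_lebesgue_integral_def
    using int[of s] int[of t] that bounds
    by (intro integral_mono) (auto simp: set_integrable_def indicator_def)
  show "(LBINT u:{0..t}. g u) - (LBINT u:{0..s}. g u) \<le> c * (t - s)" if st: "0 \<le> s" "s \<le> t" for s t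
  proof -
    have "(LBINT u:{0..t}. g u) - (LBINT u:{0..s}. g u)
      = (\<integral>u. indicator {0..t} u *\<^sub>R g u - indicator {0..s} u *\<^sub>R g u \<partial>lborel)"
      unfolding set_lebesgue_integral_def
      using int[of s] int[of t] by (intro Bochner_Integration.integral_diff[symmetric]) (auto simp: set_integrable_def)
    also have "\<dots> \<le> (\<integral>u. indicator {s..t} u *\<^sub>R c \<partial>lborel)"
    proof (rule integral_mono[OF _ const])
      show "indicator {0..t} u *\<^sub>R g u - indicator {0..s} u *\<^sub>R g u \<le> indicator {s..t} u *\<^sub>R c" for u
        using st bounds[of u] by (auto simp: indicator_def)
    qed (use int[of s] int[of t] in \<open>auto simp: set_integrable_def\<close>)
    finally show ?thesis unfolding cI[OF st(2)] .
  qed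
  show "(LBINT u:{0..s}. g u) \<le> c1 * s" if s: "0 \<le> s" "\<And>u. 0 \<le> u \<Longrightarrow> u < s \<Longrightarrow> g u \<le> c1" for s c1
  proof -
    have "(LBINT u:{0..s}. g u) \<le> (\<integral>u. indicator {0..s} u *\<^sub>R c1 \<partial>lborel)"
      unfolding set_lebesgue_integral_def
    proof (rule integral_mono_AE[OF _ const])
      show "AE u in lborel. indicator {0..s} u *\<^sub>R g u \<le> indicator {0..s} u *\<^sub>R c1"
        using AE_lborel_singleton[of s] by eventually_elim (use s in \<open>auto simp: indicator_def\<close>)
    qed (use int[of s] in \<open>auto simp: set_integrable_def\<close>)
    then show ?thesis unfolding cI[OF s(1)] by simp
  qed
qed

context cadlag_strong_Markov
begin

lemma F_subalgebra: "0 \<le> t \<Longrightarrow> subalgebra (P x) (F t)"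
  using subalg[of t] by (simp add: subalgebra_def space_P sets_P)

lemma supermartingale_set_integral_le:
  assumes Y: "supermartingale (P x) F Y" and st: "0 \<le> s" "s \<le> t" and A: "A \<in> sets (F s)"
  shows "(\<integral>\<omega>. indicator A \<omega> * Y t \<omega> \<partial>P x) \<le> (\<integral>\<omega>. indicator A \<omega> * Y s \<omega> \<partial>P x)"
proof -
  interpret prob_space "P x" by (rule prob)
  interpret finite_measure_subalgebra "P x" "F s"
    by unfold_locales (rule F_subalgebra[OF st(1)])
  have Yi: "integrable (P x) (Y t)" "integrable (P x) (Y s)"
    and le: "AE \<omega> in P x. real_cond_exp (P x) (F s) (Y t) \<omega> \<le> Y s \<omega>"
    using Y st unfolding supermartingale_def by auto
  have AP: "A \<in> sets (P x)" using F_sets[OF st(1) A] by (simp add: sets_P)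
  have "(\<integral>\<omega>. indicator A \<omega> * Y t \<omega> \<partial>P x) = (\<integral>\<omega>. indicator A \<omega> * real_cond_exp (P x) (F s) (Y t) \<omega> \<partial>P x)"
    using real_cond_exp_intA[OF Yi(1) A] by (simp add: set_lebesgue_integral_def)
  also have "\<dots> \<le> (\<integral>\<omega>. indicator A \<omega> * Y s \<omega> \<partial>P x)"
  proof (rule integral_mono_AE)
    show "AE \<omega> in P x. indicator A \<omega> * real_cond_exp (P x) (F s) (Y t) \<omega> \<le> indicator A \<omega> * Y s \<omega>"
      using le by eventually_elim (auto simp: indicator_def)
  qed (use integrable_mult_indicator[OF AP Yi(2)]
      integrable_mult_indicator[OF AP real_cond_exp_int(1)[OF Yi(1)]] in simp_all)
  finally show ?thesis .
qed

text \<open>Optional stopping of \<open>1 / V(X) - I\<close> at the first grid point where \<open>V(X) < r\<close>, carried out by summing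
  the one-step supermartingale inequalities over the events \<open>A k\<close> of no exit so far. At an exit \<open>1 / V\<close>
  exceeds \<open>1 / r\<close>, which turns the stopped mean into a bound for the exit probability.\<close>
lemma grid_exit_bound:
  assumes V: "V \<in> borel_measurable borel" "\<And>y. 1 \<le> V y"
    and I_meas: "\<And>t. 0 \<le> t \<Longrightarrow> I t \<in> borel_measurable (P x)"
    and I_bound: "\<And>t \<omega>. 0 \<le> t \<Longrightarrow> \<omega> \<in> space M \<Longrightarrow> \<bar>I t \<omega>\<bar> \<le> c * t"
    and Y: "supermartingale (P x) F Y"
    and Y_eq: "\<And>t \<omega>. 0 \<le> t \<Longrightarrow> \<omega> \<in> space M \<Longrightarrow> Y t \<omega> = 1 / V (X t \<omega>) - I t \<omega>"
    and e: "0 \<le> e" and r: "0 < r" "r \<le> V x"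
  defines "A \<equiv> \<lambda>k. {\<omega> \<in> space M. \<forall>j\<le>k. r \<le> V (X (real j * e) \<omega>)}"
  shows "(1 - measure (P x) (A K)) / r + (\<integral>\<omega>. indicator (A K) \<omega> * (1 / V (X (real K * e) \<omega>)) \<partial>P x)
    \<le> 1 / V x + (\<integral>\<omega>. (\<Sum>k<K. indicator (A k) \<omega> * (I (real (Suc k) * e) \<omega> - I (real k * e) \<omega>)) \<partial>P x)"
proof -
  interpret prob_space "P x" by (rule prob)
  have AF: "A k \<in> sets (F (real k * e))" for k
  proof -
    have "A k = (\<Inter>j\<in>{..k}. {\<omega> \<in> space M. X (real j * e) \<omega> \<in> {y. r \<le> V y}})"
      unfolding A_def by auto
    also have "\<dots> \<in> sets (F (real k * e))"
    proof (rule sets.finite_INT)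
      fix j assume "j \<in> {..k}"
      then have "real j * e \<le> real k * e" using e by (intro mult_right_mono) auto
      moreover have "{y. r \<le> V y} \<in> sets borel"
        using measurable_sets[OF V(1), of "{r..}"] by (simp add: vimage_def)
      ultimately show "{\<omega> \<in> space M. X (real j * e) \<omega> \<in> {y. r \<le> V y}} \<in> sets (F (real k * e))"
        using X_event[of "real j * e" "{y. r \<le> V y}"] filtration_mono[of "real j * e" "real k * e"] e by auto
    qed auto
    finally show ?thesis .
  qed
  have AM [measurable]: "A k \<in> sets (P x)" for k
    using F_sets[OF _ AF] e by (simp add: sets_P)
  have Xm [measurable]: "X (real k * e) \<in> P x \<rightarrow>\<^sub>M borel" for k using e by (intro X_measurable_P) auto
  have Im [measurable]: "I (real k * e) \<in> borel_measurable (P x)" for k using e by (intro I_meas) auto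
  note [measurable] = V(1)
  define v where "v k \<omega> = 1 / V (X (real k * e) \<omega>)" for k :: nat and \<omega>
  define J where "J k \<omega> = I (real k * e) \<omega>" for k :: nat and \<omega>
  have vm [measurable]: "v k \<in> borel_measurable (P x)" "J k \<in> borel_measurable (P x)" for k
    unfolding v_def J_def by measurable
  have vb: "0 \<le> v k \<omega>" "v k \<omega> \<le> 1" for k \<omega>
    using V(2)[of "X (real k * e) \<omega>"] by (auto simp: v_def)
  have vi [simp]: "integrable (P x) (\<lambda>\<omega>. indicator (A k) \<omega> * v l \<omega>)" for k l
    using vb by (intro integrable_const_bound[where B=1]) (auto simp: indicator_def)
  have Ii [simp]: "integrable (P x) (\<lambda>\<omega>. indicator (A k) \<omega> * J l \<omega>)" for k l
    using e
    by (intro integrable_const_bound[where B="\<bar>c * (real l * e)\<bar>"] AE_I2)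
       (auto simp: indicator_def space_P J_def intro!: order_trans[OF I_bound abs_ge_self])
  have di [simp]: "integrable (P x) (\<lambda>\<omega>. indicator (A k) \<omega> * (J (Suc k) \<omega> - J k \<omega>))" for k
    using Bochner_Integration.integrable_diff[OF Ii[of k "Suc k"] Ii[of k k]] by (simp only: right_diff_distrib)
  show ?thesis
    unfolding v_def[symmetric] J_def[symmetric]
  proof (induction K)
    case 0
    have "AE \<omega> in P x. \<omega> \<in> A 0"
      using start_AE[of x] AE_space by eventually_elim (use r in \<open>auto simp: A_def space_P\<close>)
    then have "measure (P x) (A 0) = 1" by (simp add: prob_eq_1)
    moreover have "(\<integral>\<omega>. indicator (A 0) \<omega> * v 0 \<omega> \<partial>P x) \<le> (\<integral>\<omega>. 1 / V x \<partial>P x)"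
    proof (rule integral_mono_AE)
      show "AE \<omega> in P x. indicator (A 0) \<omega> * v 0 \<omega> \<le> 1 / V x"
        using start_AE[of x] by eventually_elim (use V(2)[of x] in \<open>auto simp: indicator_def v_def\<close>)
    qed (use vi[of 0 0] in auto)
    ultimately show ?case by (simp add: prob_space)
  next
    case (Suc K)
    let ?D = "\<lambda>\<omega>. indicator (A K) \<omega> * (J (Suc K) \<omega> - J K \<omega>)"
    have sub: "A (Suc K) \<subseteq> A K" unfolding A_def by auto
    have ind [simp]: "integrable (P x) (indicator (A k) :: _ \<Rightarrow> real)" for k
      by (intro integrable_real_indicator AM) (simp add: emeasure_eq_measure)
    have "(measure (P x) (A K) - measure (P x) (A (Suc K))) / r
        + (\<integral>\<omega>. indicator (A (Suc K)) \<omega> * v (Suc K) \<omega> \<partial>P x)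
      = (\<integral>\<omega>. (indicator (A K) \<omega> - indicator (A (Suc K)) \<omega>) / r
        + indicator (A (Suc K)) \<omega> * v (Suc K) \<omega> \<partial>P x)"
      using AM by (subst Bochner_Integration.integral_add) (auto simp: Int_absorb2 sets.sets_into_space)
    also have "\<dots> \<le> (\<integral>\<omega>. indicator (A K) \<omega> * v (Suc K) \<omega> \<partial>P x)"
    proof (rule integral_mono_AE)
      show "AE \<omega> in P x. (indicator (A K) \<omega> - indicator (A (Suc K)) \<omega>) / r
        + indicator (A (Suc K)) \<omega> * v (Suc K) \<omega> \<le> indicator (A K) \<omega> * v (Suc K) \<omega>"
      proof (rule AE_I2)
        fix \<omega> assume "\<omega> \<in> space (P x)"
        have "V (X (real (Suc K) * e) \<omega>) \<le> r" if "\<omega> \<in> A K" "\<omega> \<notin> A (Suc K)"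
          using that unfolding A_def by (auto simp: le_Suc_eq not_le)
        then have "1 / r \<le> v (Suc K) \<omega>" if "\<omega> \<in> A K" "\<omega> \<notin> A (Suc K)"
          unfolding v_def using that V(2)[of "X (real (Suc K) * e) \<omega>"] r by (intro divide_left_mono) auto
        then show "(indicator (A K) \<omega> - indicator (A (Suc K)) \<omega>) / r
          + indicator (A (Suc K)) \<omega> * v (Suc K) \<omega> \<le> indicator (A K) \<omega> * v (Suc K) \<omega>"
          using sub by (auto simp: indicator_def)
      qed
    qed (auto intro!: Bochner_Integration.integrable_add Bochner_Integration.integrable_diff integrable_divide)
    also have "\<dots> \<le> (\<integral>\<omega>. indicator (A K) \<omega> * v K \<omega> \<partial>P x) + (\<integral>\<omega>. ?D \<omega> \<partial>P x)"
    proof -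
      have eq: "(\<integral>\<omega>. indicator (A K) \<omega> * (v k \<omega> - J k \<omega>) \<partial>P x)
        = (\<integral>\<omega>. indicator (A K) \<omega> * Y (real k * e) \<omega> \<partial>P x)" for k
        using e by (intro Bochner_Integration.integral_cong) (auto simp: v_def J_def Y_eq space_P)
      have "(\<integral>\<omega>. indicator (A K) \<omega> * (v (Suc K) \<omega> - J (Suc K) \<omega>) \<partial>P x)
        \<le> (\<integral>\<omega>. indicator (A K) \<omega> * (v K \<omega> - J K \<omega>) \<partial>P x)"
        unfolding eq using e by (intro supermartingale_set_integral_le[OF Y _ _ AF] mult_right_mono) auto
      then show ?thesis
        by (simp add: right_diff_distrib)
    qed
    finally show ?case
      using Suc unfolding Bochner_Integration.integral_sum[OF di]
      by (simp add: diff_divide_distrib)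
  qed
qed

lemma V_right_continuous:
  assumes "continuous_on UNIV V" "\<omega> \<in> space M" "0 \<le> t"
  shows "((\<lambda>u. V (X u \<omega>)) \<longlongrightarrow> V (X t \<omega>)) (at_right t)"
proof -
  have "((\<lambda>u. X u \<omega>) \<longlongrightarrow> X t \<omega>) (at_right t)"
    using cadlag_paths[OF assms(2)] assms(3) by (simp add: cadlag_def)
  then show ?thesis
    by (rule continuous_on_tendsto_compose[OF assms(1)]) auto
qed

text \<open>Apply \<open>grid_exit_bound\<close> on the refinements \<open>d / 2^i\<close> of the given grid. On \<open>{V \<ge> r}\<close> the drift is at
  most \<open>\<phi>(1 / r)\<close>, as \<open>\<phi>\<close> is monotone and \<open>r > l\<^sub>0\<close> switches off the term with \<open>b\<close>. The excess caused by
  late detection of the exit tends to zero path by path, and in mean by dominated convergence.\<close>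
lemma stay_above_prob_ge:
  fixes V :: "'x \<Rightarrow> real" and \<phi> :: "real \<Rightarrow> real"
  assumes V: "continuous_on UNIV V" "\<And>y. 1 \<le> V y"
    and \<phi>: "\<And>u. u \<in> {0<..1} \<Longrightarrow> 0 \<le> \<phi> u" "mono_on {0<..1} \<phi>" "continuous_on {0<..1} \<phi>"
    and b: "0 \<le> b"
    and Y: "supermartingale (P x) F (\<lambda>t \<omega>. 1 / V (X t \<omega>) - (LBINT u:{0..t}. \<phi> (1 / V (X u \<omega>)))
           - b * (LBINT u:{0..t}. indicator {y. V y \<le> l0} (X u \<omega>)))"
    and r: "1 \<le> r" "l0 < r" "r \<le> V x" and d: "0 < d"
  shows "1 - r / V x - r * \<phi> (1 / r) * (real n * d)
    \<le> measure (P x) {\<omega> \<in> space M. \<forall>j<n. r \<le> V (X (real j * d) \<omega>)}"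
proof -
  interpret prob_space "P x" by (rule prob)
  define p where "p \<omega> u = \<phi> (1 / V (X u \<omega>))" for \<omega> u
  define h where "h \<omega> u = (indicator {y. V y \<le> l0} (X u \<omega>) :: real)" for \<omega> u
  define g where "g \<omega> u = p \<omega> u + b * h \<omega> u" for \<omega> u
  define I where "I t \<omega> = (LBINT u:{0..t}. g \<omega> u)" for t \<omega>
  define c where "c = \<phi> 1 + b"
  let ?c1 = "\<phi> (1 / r)"
  have inv_V: "1 / V y \<in> {0<..1}" for y using V(2)[of y] by auto
  have p_bounds: "0 \<le> p \<omega> u" "p \<omega> u \<le> \<phi> 1" for \<omega> u
    unfolding p_def using \<phi>(1)[OF inv_V] mono_onD[OF \<phi>(2) inv_V, of 1] inv_V by auto
  have h_bounds: "0 \<le> h \<omega> u" "h \<omega> u \<le> 1" for \<omega> u by (auto simp: h_def indicator_def)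
  have g_bounds: "0 \<le> g \<omega> u" "g \<omega> u \<le> c" for \<omega> u
    using p_bounds[of \<omega> u] h_bounds[of \<omega> u] b mult_left_mono[OF h_bounds(2) b, of \<omega> u]
    by (auto simp: g_def c_def)
  have c0: "0 \<le> c" using g_bounds[of undefined 0] by linarith
  have c10: "0 \<le> ?c1" using r by (intro \<phi>(1)) auto
  have V_meas [measurable]: "V \<in> borel_measurable borel" by (rule borel_measurable_continuous_onI[OF V(1)])
  have p_meas: "(\<lambda>u. indicator {0..} u * p \<omega> u) \<in> borel_measurable borel"
    and h_meas: "(\<lambda>u. indicator {0..} u * h \<omega> u) \<in> borel_measurable borel"
    if \<omega>: "\<omega> \<in> space M" for \<omega>
  proof -
    show "(\<lambda>u. indicator {0..} u * p \<omega> u) \<in> borel_measurable borel"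
    proof (rule right_continuous_measurable)
      fix t :: real assume "0 \<le> t"
      then have "((\<lambda>u. 1 / V (X u \<omega>)) \<longlongrightarrow> 1 / V (X t \<omega>)) (at_right t)"
        using V(2)[of "X t \<omega>"] by (intro tendsto_divide tendsto_const V_right_continuous[OF V(1) \<omega>]) auto
      then show "(p \<omega> \<longlongrightarrow> p \<omega> t) (at_right t)"
        unfolding p_def using inv_V
        by (intro continuous_on_tendsto_compose[OF \<phi>(3)]) auto
    qed
    have [measurable]: "(\<lambda>u. indicator {0..} u * V (X u \<omega>)) \<in> borel_measurable borel"
      by (rule right_continuous_measurable) (rule V_right_continuous[OF V(1) \<omega>])
    have "(\<lambda>u::real. indicator {0..} u * (indicator {..l0} (indicator {0..} u * V (X u \<omega>)) :: real)) \<in> borel_measurable borel"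
      by measurable
    then show "(\<lambda>u. indicator {0..} u * h \<omega> u) \<in> borel_measurable borel"
      by (rule measurable_cong[THEN iffD1, rotated]) (auto simp: h_def indicator_def)
  qed
  have g_meas: "(\<lambda>u. indicator {0..} u * g \<omega> u) \<in> borel_measurable borel" if "\<omega> \<in> space M" for \<omega>
  proof -
    note [measurable] = p_meas[OF that] h_meas[OF that]
    have "(\<lambda>u. indicator {0..} u * p \<omega> u + b * (indicator {0..} u * h \<omega> u)) \<in> borel_measurable borel"
      by measurable
    then show ?thesis by (simp add: g_def algebra_simps)
  qed
  have I_eq: "I t \<omega> = (LBINT u:{0..t}. p \<omega> u) + b * (LBINT u:{0..t}. h \<omega> u)" if "\<omega> \<in> space M" for t \<omega>
    unfolding I_def g_def
    using primitive_integrable[OF p_meas[OF that] p_bounds, of t]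
      primitive_integrable[OF h_meas[OF that] h_bounds, of t]
    by (subst set_integral_add) auto
  note I0 = primitive_0[OF g_meas g_bounds, folded I_def]
  note I_mono = primitive_mono[OF g_meas g_bounds, folded I_def]
  note I_lip = primitive_lipschitz[OF g_meas g_bounds, folded I_def]
  note I_le = primitive_le[OF g_meas g_bounds, folded I_def]
  have Y_eq: "1 / V (X t \<omega>) - (LBINT u:{0..t}. \<phi> (1 / V (X u \<omega>)))
           - b * (LBINT u:{0..t}. indicator {y. V y \<le> l0} (X u \<omega>)) = 1 / V (X t \<omega>) - I t \<omega>"
    if "\<omega> \<in> space M" for t \<omega>
    using I_eq[OF that, of t] by (simp add: p_def h_def)
  have I_meas: "I t \<in> borel_measurable (P x)" if t: "0 \<le> t" for t
  proof -
    let ?Y = "\<lambda>\<omega>. 1 / V (X t \<omega>) - (LBINT u:{0..t}. \<phi> (1 / V (X u \<omega>)))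
           - b * (LBINT u:{0..t}. indicator {y. V y \<le> l0} (X u \<omega>))"
    have "integrable (P x) ?Y"
      using Y t unfolding supermartingale_def by auto
    then have [measurable]: "?Y \<in> borel_measurable (P x)" by (rule borel_measurable_integrable)
    have [measurable]: "X t \<in> P x \<rightarrow>\<^sub>M borel" using t by (rule X_measurable_P)
    have "(\<lambda>\<omega>. 1 / V (X t \<omega>) - ?Y \<omega>) \<in> borel_measurable (P x)" by measurable
    then show ?thesis
      by (rule measurable_cong[THEN iffD1, rotated]) (simp add: I_eq p_def h_def space_P)
  qed
  have I_bound: "\<bar>I t \<omega>\<bar> \<le> c * t" if "0 \<le> t" "\<omega> \<in> space M" for t \<omega>
    using I0[OF that(2)] I_mono[OF that(2) order_refl that(1)] I_lip[OF that(2) order_refl that(1)] by simp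
  define A where "A i k = {\<omega> \<in> space M. \<forall>j\<le>k. r \<le> V (X (real j * (d / 2 ^ i)) \<omega>)}" for i k :: nat
  define J where "J i \<omega> = (\<Sum>k<n * 2 ^ i. indicator (A i k) \<omega>
     * (I (real (Suc k) * (d / 2 ^ i)) \<omega> - I (real k * (d / 2 ^ i)) \<omega>))" for i \<omega>
  \<comment> \<open>The excess of the stopped drift over the bound that holds in continuous time.\<close>
  define E where "E i \<omega> = max 0 (J i \<omega> - ?c1 * (real n * d))" for i \<omega>
  let ?B = "{\<omega> \<in> space M. \<forall>j<n. r \<le> V (X (real j * d) \<omega>)}"
  have grid: "0 \<le> real k * (d / 2 ^ i)" for i k :: nat using d by simp
  have Xm [measurable]: "X (real k * (d / 2 ^ i)) \<in> P x \<rightarrow>\<^sub>M borel" for i k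
    by (rule X_measurable_P[OF grid])
  have Am [measurable]: "A i k \<in> sets (P x)" for i k
    unfolding A_def space_P[symmetric, of x] by measurable
  have [measurable]: "I (real k * (d / 2 ^ i)) \<in> borel_measurable (P x)" for i k
    by (rule I_meas[OF grid])
  have Jm [measurable]: "J i \<in> borel_measurable (P x)" for i
    unfolding J_def[abs_def] by measurable
  have Em [measurable]: "E i \<in> borel_measurable (P x)" for i
    unfolding E_def[abs_def] by measurable
  have step: "real k * (d / 2 ^ i) \<le> real (Suc k) * (d / 2 ^ i)" for i k :: nat
    using d by (intro mult_right_mono) auto
  have J_bounds: "0 \<le> J i \<omega>" "J i \<omega> \<le> c * (real n * d)" if \<omega>: "\<omega> \<in> space M" for i \<omega>
  proof -
    have inc: "0 \<le> I (real (Suc k) * (d / 2 ^ i)) \<omega> - I (real k * (d / 2 ^ i)) \<omega>" for k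
      using I_mono[OF \<omega> grid step, of k i] by simp
    show "0 \<le> J i \<omega>" unfolding J_def by (intro sum_nonneg mult_nonneg_nonneg inc) auto
    have "J i \<omega> \<le> (\<Sum>k<n * 2 ^ i. I (real (Suc k) * (d / 2 ^ i)) \<omega> - I (real k * (d / 2 ^ i)) \<omega>)"
      unfolding J_def using inc by (intro sum_mono mult_left_le_one_le) (auto simp: indicator_def)
    also have "\<dots> = I (real n * d) \<omega>"
      using sum_lessThan_telescope[of "\<lambda>k. I (real k * (d / 2 ^ i)) \<omega>" "n * 2 ^ i"] I0[OF \<omega>] by simp
    also have "\<dots> \<le> c * (real n * d)" using I_bound[of "real n * d" \<omega>] \<omega> d by simp
    finally show "J i \<omega> \<le> c * (real n * d)" .
  qed
  have E_bounds: "0 \<le> E i \<omega>" "E i \<omega> \<le> c * (real n * d)" if "\<omega> \<in> space M" for i \<omega>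
  proof -
    have "0 \<le> ?c1 * (real n * d)" "0 \<le> c * (real n * d)" using c10 c0 d by simp_all
    then show "0 \<le> E i \<omega>" "E i \<omega> \<le> c * (real n * d)"
      using J_bounds[OF that, of i] unfolding E_def by auto
  qed
  have E_lim: "(\<lambda>i. E i \<omega>) \<longlonglongrightarrow> 0" if \<omega>: "\<omega> \<in> space M" for \<omega>
  proof (rule order_tendstoI)
    fix a :: real assume "a < 0"
    then show "\<forall>\<^sub>F i in sequentially. a < E i \<omega>"
      using E_bounds(1)[OF \<omega>] by (auto intro!: always_eventually intro: less_le_trans)
  next
    fix a :: real assume a: "0 < a"
    have gs: "g \<omega> u \<le> ?c1" if "r \<le> V (X u \<omega>)" for u
    proof -
      have "1 / V (X u \<omega>) \<le> 1 / r" using that r by (intro divide_left_mono) auto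
      then have "p \<omega> u \<le> ?c1" unfolding p_def using inv_V r by (intro mono_onD[OF \<phi>(2)]) auto
      then show ?thesis using that r by (simp add: g_def h_def)
    qed
    have "\<forall>\<^sub>F i in sequentially.
      (\<Sum>k<n * 2 ^ i. if \<forall>j\<le>k. r \<le> V (X (real j * (d / 2 ^ i)) \<omega>)
         then I (real (Suc k) * (d / 2 ^ i)) \<omega> - I (real k * (d / 2 ^ i)) \<omega> else 0)
      \<le> ?c1 * (real n * d) + a / 2"
    proof (rule stopped_grid_sum_le[where I="\<lambda>t. I t \<omega>" and a="\<lambda>u. V (X u \<omega>)" and c=c])
      show "I s \<omega> \<le> ?c1 * s" if "0 \<le> s" "\<And>u. 0 \<le> u \<Longrightarrow> u < s \<Longrightarrow> r \<le> V (X u \<omega>)" for s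
        using that by (intro I_le[OF \<omega>] gs) auto
    qed (use V_right_continuous[OF V(1) \<omega>] I0[OF \<omega>] I_mono[OF \<omega>] I_lip[OF \<omega>] d c0 c10 a in auto)
    then show "\<forall>\<^sub>F i in sequentially. E i \<omega> < a"
    proof eventually_elim
      case (elim i)
      have "J i \<omega> = (\<Sum>k<n * 2 ^ i. if \<forall>j\<le>k. r \<le> V (X (real j * (d / 2 ^ i)) \<omega>)
         then I (real (Suc k) * (d / 2 ^ i)) \<omega> - I (real k * (d / 2 ^ i)) \<omega> else 0)"
        unfolding J_def A_def using \<omega> by (intro sum.cong) (simp_all add: indicator_def)
      with elim a show ?case unfolding E_def by simp
    qed
  qed
  have lim: "(\<lambda>i. \<integral>\<omega>. E i \<omega> \<partial>P x) \<longlonglongrightarrow> (\<integral>\<omega>. 0 \<partial>P x)"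
  proof (rule integral_dominated_convergence[where w="\<lambda>_. c * (real n * d)"])
    show "AE \<omega> in P x. (\<lambda>i. E i \<omega>) \<longlonglongrightarrow> 0" using E_lim by (intro AE_I2) (simp add: space_P)
    show "AE \<omega> in P x. norm (E i \<omega>) \<le> c * (real n * d)" for i
      using E_bounds by (intro AE_I2) (simp add: space_P)
  qed auto
  have main: "1 - r / V x - r * ?c1 * (real n * d) - r * (\<integral>\<omega>. E i \<omega> \<partial>P x) \<le> prob ?B" for i
  proof -
    have iJ: "integrable (P x) (J i)" and iE: "integrable (P x) (E i)"
      using J_bounds E_bounds
      by (auto intro!: integrable_const_bound[where B="c * (real n * d)"] AE_I2 simp: space_P)
    have "(1 - prob (A i (n * 2 ^ i))) / r
        + (\<integral>\<omega>. indicator (A i (n * 2 ^ i)) \<omega> * (1 / V (X (real (n * 2 ^ i) * (d / 2 ^ i)) \<omega>)) \<partial>P x)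
      \<le> 1 / V x + (\<integral>\<omega>. J i \<omega> \<partial>P x)"
      unfolding A_def J_def
      by (rule grid_exit_bound[OF V_meas V(2) I_meas I_bound Y]) (use Y_eq d r in auto)
    moreover have "0 \<le> (\<integral>\<omega>. indicator (A i (n * 2 ^ i)) \<omega> * (1 / V (X (real (n * 2 ^ i) * (d / 2 ^ i)) \<omega>)) \<partial>P x)"
      using inv_V by (intro Bochner_Integration.integral_nonneg mult_nonneg_nonneg) (auto intro: less_imp_le)
    moreover have "(\<integral>\<omega>. J i \<omega> \<partial>P x) \<le> (\<integral>\<omega>. ?c1 * (real n * d) + E i \<omega> \<partial>P x)"
      using iJ iE by (intro integral_mono) (auto simp: E_def)
    moreover have "(\<integral>\<omega>. ?c1 * (real n * d) + E i \<omega> \<partial>P x) = ?c1 * (real n * d) + (\<integral>\<omega>. E i \<omega> \<partial>P x)"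
      using iE by (simp add: prob_space)
    ultimately have "(1 - prob (A i (n * 2 ^ i))) / r \<le> 1 / V x + (?c1 * (real n * d) + (\<integral>\<omega>. E i \<omega> \<partial>P x))"
      by linarith
    then have "1 - prob (A i (n * 2 ^ i)) \<le> (1 / V x + (?c1 * (real n * d) + (\<integral>\<omega>. E i \<omega> \<partial>P x))) * r"
      using r by (simp add: pos_divide_le_eq)
    also have "\<dots> = r / V x + r * ?c1 * (real n * d) + r * (\<integral>\<omega>. E i \<omega> \<partial>P x)"
      by (simp add: algebra_simps)
    finally have "1 - r / V x - r * ?c1 * (real n * d) - r * (\<integral>\<omega>. E i \<omega> \<partial>P x) \<le> prob (A i (n * 2 ^ i))"
      by linarith
    also have "\<dots> \<le> prob ?B"
    proof (rule finite_measure_mono)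
      show "A i (n * 2 ^ i) \<subseteq> ?B"
      proof (safe)
        fix \<omega> j assume \<omega>: "\<omega> \<in> A i (n * 2 ^ i)" and j: "j < n"
        have "j * 2 ^ i \<le> n * 2 ^ i" using j by simp
        with \<omega> have "r \<le> V (X (real (j * 2 ^ i) * (d / 2 ^ i)) \<omega>)" unfolding A_def by blast
        then show "r \<le> V (X (real j * d) \<omega>)" by simp
      qed (simp add: A_def)
      have [measurable]: "X (real j * d) \<in> P x \<rightarrow>\<^sub>M borel" for j using d by (intro X_measurable_P) auto
      show "?B \<in> sets (P x)" unfolding space_P[symmetric, of x] by measurable
    qed
    finally show ?thesis .
  qed
  have "(\<lambda>i. 1 - r / V x - r * ?c1 * (real n * d) - r * (\<integral>\<omega>. E i \<omega> \<partial>P x))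
    \<longlonglongrightarrow> 1 - r / V x - r * ?c1 * (real n * d) - r * 0"
    using lim by (intro tendsto_intros) simp
  from LIMSEQ_le_const2[OF this] main show ?thesis by auto
qed

end

section \<open>Climbing, and crossing upwards\<close>

context cadlag_strong_Markov
begin

text \<open>\<open>V(X)\<close> exceeds \<open>R\<close> on a whole interval to the right of some time before \<open>V(X)\<close> first falls below \<open>l\<close>;
  a fine grid has a point in this interval. The horizon of \<open>4 ^ n\<close> steps of size \<open>h / 2^n\<close> is \<open>2^n h\<close>,
  which tends to infinity while the mesh tends to zero.\<close>
lemma grid_reach_eventually:
  assumes V: "continuous_on UNIV V" and \<omega>: "\<omega> \<in> space M" and h: "0 < h"
    and less: "time_above V X R \<omega> < time_below V X l \<omega>"
  shows "\<forall>\<^sub>F n in sequentially. \<exists>k\<le>4 ^ n. R < V (X (real k * (h / 2 ^ n)) \<omega>) \<and>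
      (\<forall>j<k. l \<le> V (X (real j * (h / 2 ^ n)) \<omega>))"
proof -
  let ?a = "\<lambda>u. V (X u \<omega>)"
  from less obtain t0 where t0: "0 \<le> t0" "R < ?a t0" "ennreal t0 < time_below V X l \<omega>"
    unfolding time_above_def Inf_less_iff by auto
  have before: "l \<le> ?a u" if "0 \<le> u" "ennreal u < time_below V X l \<omega>" for u
  proof (rule ccontr)
    assume "\<not> l \<le> ?a u"
    then have "time_below V X l \<omega> \<le> ennreal u"
      unfolding time_below_def using that(1) by (intro Inf_lower) auto
    with that(2) show False by simp
  qed
  obtain t1 where t1: "t0 < t1" "ennreal t1 \<le> time_below V X l \<omega>"
  proof (cases "time_below V X l \<omega>")
    case (real s)
    then show ?thesis using t0 that[of s] by (simp add: ennreal_less_iff)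
  next
    case top
    then show ?thesis using that[of "t0 + 1"] by simp
  qed
  have "\<forall>\<^sub>F u in at_right t0. R < ?a u"
    by (rule order_tendstoD(1)[OF V_right_continuous[OF V \<omega> t0(1)] t0(2)])
  then obtain t2 where t2: "t0 < t2" "\<And>u. t0 < u \<Longrightarrow> u < t2 \<Longrightarrow> R < ?a u"
    unfolding eventually_at_right_field by auto
  have "\<forall>\<^sub>F n in sequentially. \<exists>k. t0 < real k * (h / 2 ^ n) \<and> real k * (h / 2 ^ n) < min t1 t2"
    using t0 t1 t2 h by (intro dyadic_grid_eventually_between) auto
  moreover have "\<forall>\<^sub>F n in sequentially. t1 / h \<le> 2 ^ n"
  proof -
    obtain N where "t1 / h < 2 ^ N" using real_arch_pow[of 2 "t1 / h"] by auto
    then show ?thesis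
      by (auto simp: eventually_sequentially intro!: exI[of _ N] intro: order_trans[OF less_imp_le power_increasing])
  qed
  ultimately show ?thesis
  proof eventually_elim
    case (elim n)
    then obtain k where k: "t0 < real k * (h / 2 ^ n)" "real k * (h / 2 ^ n) < t1" "real k * (h / 2 ^ n) < t2"
      by auto
    have "real k * h < t1 * 2 ^ n" using k(2) by (simp add: field_simps)
    also have "\<dots> \<le> (2 ^ n * h) * 2 ^ n" using elim h by (intro mult_right_mono) (auto simp: field_simps)
    finally have "real k < 2 ^ n * 2 ^ n" using h by (simp add: field_simps)
    also have "2 ^ n * 2 ^ n = real (4 ^ n)" by (simp flip: power_mult_distrib)
    finally have "k \<le> 4 ^ n" by simp
    moreover have "l \<le> ?a (real j * (h / 2 ^ n))" if "j < k" for j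
    proof (rule before)
      have "real j * (h / 2 ^ n) < real k * (h / 2 ^ n)" using that h by (intro mult_strict_right_mono) auto
      then have "real j * (h / 2 ^ n) < t1" using k by simp
      then have "ennreal (real j * (h / 2 ^ n)) < ennreal t1" using h t0 t1 by (simp add: ennreal_less_iff)
      then show "ennreal (real j * (h / 2 ^ n)) < time_below V X l \<omega>" using t1(2) by (rule less_le_trans)
    qed (use h in simp)
    ultimately show ?case using t2(2)[OF k(1,3)] by blast
  qed
qed

text \<open>Fatou's lemma for the grid events. A non-measurable event on the left is harmless, as its measure is
  then zero.\<close>
lemma hitting_prob_le_liminf_reach:
  assumes V: "continuous_on UNIV V" and h: "0 < h"
  shows "ennreal (measure (P x) {\<omega> \<in> space (P x). time_above V X R \<omega> < time_below V X l \<omega>})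
    \<le> liminf (\<lambda>n. reach (transition (h / 2 ^ n)) {y. V y < l} {y. R < V y} (4 ^ n) x)"
proof -
  interpret prob_space "P x" by (rule prob)
  have V_meas [measurable]: "V \<in> borel_measurable borel" by (rule borel_measurable_continuous_onI[OF V])
  define E where "E n = {\<omega> \<in> space M. \<exists>k\<le>4 ^ n. X (0 + real k * (h / 2 ^ n)) \<omega> \<in> {y. R < V y} \<and>
      (\<forall>j<k. X (0 + real j * (h / 2 ^ n)) \<omega> \<notin> {y. V y < l})}" for n :: nat
  have [measurable]: "X (0 + real k * (h / 2 ^ n)) \<in> P x \<rightarrow>\<^sub>M borel" for k n
    using h by (intro X_measurable_P) auto
  have Em [measurable]: "E n \<in> sets (P x)" for n
    unfolding E_def space_P[symmetric, of x] by measurable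
  have E_le: "emeasure (P x) (E n) \<le> reach (transition (h / 2 ^ n)) {y. V y < l} {y. R < V y} (4 ^ n) x" for n
  proof -
    let ?R = "reach (transition (h / 2 ^ n)) {y. V y < l} {y. R < V y} (4 ^ n)"
    have h0: "0 \<le> h / 2 ^ n" using h by simp
    have sp: "space M \<in> sets (F 0)" using sets.top[of "F 0"] by (simp add: F_space)
    have B: "{y. V y < l} \<in> sets borel" "{y. R < V y} \<in> sets borel"
      using measurable_sets[OF V_meas, of "{..<l}"] measurable_sets[OF V_meas, of "{R<..}"]
      by (auto simp: vimage_def)
    have R: "?R \<in> borel_measurable borel"
      using B by (intro reach_measurable[OF transition_kernel[OF h0]]) auto
    have Esp: "space M \<inter> E n = E n" unfolding E_def by blast
    have "emeasure (P x) (E n) \<le> (\<integral>\<^sup>+\<omega>. indicator (space M) \<omega> * ?R (X 0 \<omega>) \<partial>P x)"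
      using emeasure_reach_le[OF h0 order_refl sp B, of x "4 ^ n"]
      unfolding E_def[symmetric] Esp .
    also have "\<dots> = (\<integral>\<^sup>+\<omega>. ?R (X 0 \<omega>) \<partial>P x)"
      by (intro nn_integral_cong) (simp add: space_P)
    also have "\<dots> = ?R x" by (rule integral_at_start[OF R])
    finally show ?thesis .
  qed
  have "emeasure (P x) {\<omega> \<in> space (P x). time_above V X R \<omega> < time_below V X l \<omega>}
    \<le> (\<integral>\<^sup>+\<omega>. liminf (\<lambda>n. indicator (E n) \<omega>) \<partial>P x)"
  proof (cases "{\<omega> \<in> space (P x). time_above V X R \<omega> < time_below V X l \<omega>} \<in> sets (P x)")
    case True
    have "indicator {\<omega> \<in> space (P x). time_above V X R \<omega> < time_below V X l \<omega>} \<omega>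
      \<le> liminf (\<lambda>n. indicator (E n) \<omega> :: ennreal)" for \<omega>
    proof (cases "\<omega> \<in> {\<omega> \<in> space (P x). time_above V X R \<omega> < time_below V X l \<omega>}")
      case True
      then have \<omega>: "\<omega> \<in> space M" and less: "time_above V X R \<omega> < time_below V X l \<omega>" by (auto simp: space_P)
      have "\<forall>\<^sub>F n in sequentially. (1::ennreal) \<le> indicator (E n) \<omega>"
        using grid_reach_eventually[OF V \<omega> h less]
        by eventually_elim (use \<omega> in \<open>auto simp: E_def indicator_def not_less\<close>)
      with True show ?thesis by (simp add: Liminf_bounded)
    qed simp
    then have "(\<integral>\<^sup>+\<omega>. indicator {\<omega> \<in> space (P x). time_above V X R \<omega> < time_below V X l \<omega>} \<omega> \<partial>P x)
      \<le> (\<integral>\<^sup>+\<omega>. liminf (\<lambda>n. indicator (E n) \<omega>) \<partial>P x)"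
      by (intro nn_integral_mono)
    then show ?thesis using True by simp
  next
    case False
    then show ?thesis by (simp add: emeasure_notin_sets)
  qed
  also have "\<dots> \<le> liminf (\<lambda>n. \<integral>\<^sup>+\<omega>. indicator (E n) \<omega> \<partial>P x)"
    by (rule nn_integral_liminf) simp
  also have "\<dots> = liminf (\<lambda>n. emeasure (P x) (E n))" by simp
  also have "\<dots> \<le> liminf (\<lambda>n. reach (transition (h / 2 ^ n)) {y. V y < l} {y. R < V y} (4 ^ n) x)"
    by (intro Liminf_mono always_eventually allI E_le)
  finally show ?thesis by (simp add: emeasure_eq_measure)
qed

text \<open>If all crossing probabilities vanished, then for \<open>\<pi>\<close>-almost every \<open>x\<close> with \<open>V x < l\<close> the path from \<open>x\<close>
  would almost surely be below \<open>l + 1\<close> at all positive rational times, and by right-continuity at most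
  \<open>l + 1\<close> at all times.\<close>
lemma exists_upcrossing_time:
  assumes inv: "invariant_prob P X \<pi>" and V: "continuous_on UNIV V"
    and unbounded: "\<And>x. AE \<omega> in P x. Limsup at_top (\<lambda>t. ereal (V (X t \<omega>))) = \<infinity>"
    and pos: "0 < emeasure \<pi> {y. V y < l}"
  shows "\<exists>h>0. 0 < (\<integral>\<^sup>+x. indicator {y. V y < l} x *
    kernel_op (transition h) (indicator {y. l + 1 \<le> V y}) x \<partial>\<pi>)"
proof (rule ccontr)
  assume neg: "\<not> ?thesis"
  have V_meas [measurable]: "V \<in> borel_measurable borel" by (rule borel_measurable_continuous_onI[OF V])
  have s\<pi> [measurable_cong]: "sets \<pi> = sets borel" using inv by (simp add: invariant_prob_def)
  have sp: "space \<pi> = UNIV" using sets_eq_imp_space_eq[OF s\<pi>] by simp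
  let ?A = "{y. l + 1 \<le> V y}"
  have Am [measurable]: "?A \<in> sets borel" and Bm [measurable]: "{y. V y < l} \<in> sets borel"
    using measurable_sets[OF V_meas, of "{..<l}"] measurable_sets[OF V_meas, of "{l+1..}"]
    by (auto simp: vimage_def)
  define Q where "Q = {h :: rat. 0 < h}"
  have "AE x in \<pi>. \<forall>h\<in>Q. indicator {y. V y < l} x * kernel_op (transition (of_rat h)) (indicator ?A) x = 0"
  proof (rule AE_ball_countable')
    fix h assume "h \<in> Q"
    then have h: "0 < (of_rat h :: real)" by (simp add: Q_def)
    note [measurable] = transition_op_measurable[OF less_imp_le[OF h]]
    have "(\<integral>\<^sup>+x. indicator {y. V y < l} x * kernel_op (transition (of_rat h)) (indicator ?A) x \<partial>\<pi>) = 0"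
      using neg h by (auto simp: not_gr_zero)
    then show "AE x in \<pi>. indicator {y. V y < l} x * kernel_op (transition (of_rat h)) (indicator ?A) x = 0"
      by (subst (asm) nn_integral_0_iff_AE) auto
  qed simp
  moreover have "\<not> (AE x in \<pi>. \<not> V x < l)"
    using pos AE_iff_measurable[of "{y. V y < l}" \<pi> "\<lambda>x. \<not> V x < l"] by (auto simp: sp s\<pi>)
  ultimately obtain x where x: "V x < l"
    "\<And>h. h \<in> Q \<Longrightarrow> kernel_op (transition (of_rat h)) (indicator ?A) x = 0"
  proof -
    assume ae: "AE x in \<pi>. \<forall>h\<in>Q. indicator {y. V y < l} x * kernel_op (transition (of_rat h)) (indicator ?A) x = 0"
      and nn: "\<not> (AE x in \<pi>. \<not> V x < l)"
    show thesis
    proof (rule ccontr)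
      assume "\<not> thesis"
      then have no: "\<And>x. V x < l \<Longrightarrow> \<exists>h\<in>Q. kernel_op (transition (of_rat h)) (indicator ?A) x \<noteq> 0"
        using that by blast
      from ae have "AE x in \<pi>. \<not> V x < l"
      proof eventually_elim
        case (elim x)
        then show ?case using no[of x] by auto
      qed
      with nn show False ..
    qed
  qed
  have "AE \<omega> in P x. \<forall>h\<in>Q. V (X (of_rat h) \<omega>) < l + 1"
  proof (rule AE_ball_countable')
    fix h assume hQ: "h \<in> Q"
    then have h: "0 \<le> (of_rat h :: real)" by (simp add: Q_def)
    have [measurable]: "X (of_rat h) \<in> P x \<rightarrow>\<^sub>M borel" by (rule X_measurable_P[OF h])
    have "(\<integral>\<^sup>+\<omega>. indicator ?A (X (of_rat h) \<omega>) \<partial>P x) = 0"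
      using x(2)[OF hQ] h by (subst (asm) transition_op) auto
    then have "AE \<omega> in P x. indicator ?A (X (of_rat h) \<omega>) = (0 :: ennreal)"
      by (subst (asm) nn_integral_0_iff_AE) auto
    then show "AE \<omega> in P x. V (X (of_rat h) \<omega>) < l + 1"
      by eventually_elim (auto simp: indicator_def not_le split: if_splits)
  qed simp
  with unbounded[of x] AE_space have "AE \<omega> in P x. False"
  proof eventually_elim
    case (elim \<omega>)
    then have \<omega>: "\<omega> \<in> space M" by (simp add: space_P)
    have le: "V (X t \<omega>) \<le> l + 1" if "0 \<le> t" for t
    proof (rule ccontr)
      assume "\<not> V (X t \<omega>) \<le> l + 1"
      then have "\<forall>\<^sub>F u in at_right t. l + 1 < V (X u \<omega>)"
        by (intro order_tendstoD(1)[OF V_right_continuous[OF V \<omega> that]]) simp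
      then obtain t' where t': "t < t'" "\<And>u. t < u \<Longrightarrow> u < t' \<Longrightarrow> l + 1 < V (X u \<omega>)"
        unfolding eventually_at_right_field by auto
      obtain h where h: "t < of_rat h" "of_rat h < t'" using of_rat_dense[OF t'(1)] by auto
      then have "(0::real) < of_rat h" using that by linarith
      then have "h \<in> Q" by (simp add: Q_def)
      with elim t'(2)[OF h] show False by force
    qed
    have "Limsup at_top (\<lambda>t. ereal (V (X t \<omega>))) \<le> ereal (l + 1)"
    proof (rule Limsup_bounded)
      show "\<forall>\<^sub>F t in at_top. ereal (V (X t \<omega>)) \<le> ereal (l + 1)"
        using eventually_ge_at_top[of 0] by eventually_elim (simp add: le)
    qed
    with elim show False by simp
  qed
  then show False using prob_space.AE_False[OF prob] by blast
qed

end

section \<open>The tail of the invariant law\<close>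

lemma mult_liminf_le:
  fixes a :: ennreal
  shows "a * liminf f \<le> liminf (\<lambda>n. a * f n)"
  unfolding liminf_SUP_INF SUP_mult_left_ennreal
  by (intro SUP_mono' INF_greatest mult_left_mono INF_lower) auto

context cadlag_strong_Markov
begin

text \<open>On the grid of mesh \<open>h / 2^n\<close>, Kac's inequality over the \<open>2^n\<close> steps of a crossing bounds \<open>2^n \<pi>(V \<ge> r)\<close>
  from below by the crossing rate, times the probability of climbing above \<open>R\<close>, times \<open>q k\<close>, where \<open>k\<close> is
  the number of grid points in a stay of length \<open>t\<close>. Since \<open>k\<close> is about \<open>2^n t / h\<close>, the factors \<open>2^n\<close> cancel.
  The loss of a factor \<open>2\<close> absorbs the rounding of \<open>k\<close>. Fatou's lemma passes to the limit in the
  climbing probability, as the mesh at which a climb becomes visible may depend on the starting point.\<close>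
lemma invariant_tail_ge:
  assumes inv: "invariant_prob P X \<pi>" and V: "continuous_on UNIV V"
    and h: "0 < h" and t: "0 < t" and q: "0 \<le> q" and lr: "l \<le> r"
    and stay: "\<And>y n d. R < V y \<Longrightarrow> 0 < d \<Longrightarrow> real n * d \<le> t \<Longrightarrow>
      q \<le> measure (P y) {\<omega> \<in> space M. \<forall>j<n. r \<le> V (X (real j * d) \<omega>)}"
    and climb: "\<And>y. l + 1 \<le> V y \<Longrightarrow>
      c0 \<le> measure (P y) {\<omega> \<in> space (P y). time_above V X R \<omega> < time_below V X l \<omega>}"
  shows "ennreal (q * (t / (2 * h))) * (ennreal c0 * (\<integral>\<^sup>+x. indicator {y. V y < l} x *
      kernel_op (transition h) (indicator {y. l + 1 \<le> V y}) x \<partial>\<pi>)) \<le> emeasure \<pi> {y. r \<le> V y}"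
proof -
  let ?A = "{y. l + 1 \<le> V y}" and ?B = "{y. V y < l}" and ?C = "{y. r \<le> V y}" and ?D = "{y. R < V y}"
  have V_meas [measurable]: "V \<in> borel_measurable borel" by (rule borel_measurable_continuous_onI[OF V])
  have s\<pi> [measurable_cong]: "sets \<pi> = sets borel" using inv by (simp add: invariant_prob_def)
  have A [measurable]: "?A \<in> sets borel" and B [measurable]: "?B \<in> sets borel"
    and C [measurable]: "?C \<in> sets borel" and D [measurable]: "?D \<in> sets borel"
    using measurable_sets[OF V_meas, of "{..<l}"] measurable_sets[OF V_meas, of "{l+1..}"]
      measurable_sets[OF V_meas, of "{r..}"] measurable_sets[OF V_meas, of "{R<..}"]
    by (auto simp: vimage_def)
  define K where "K n = transition (h / 2 ^ n)" for n :: nat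
  define W where "W n y = indicator ?A y * reach (K n) ?B ?D (4 ^ n) y" for n y
  have hn: "0 < h / 2 ^ n" for n :: nat using h by simp
  have hn0: "0 \<le> h / 2 ^ n" for n :: nat using h by simp
  have h0: "0 \<le> h" using h by simp
  have [measurable]: "reach (K n) ?B ?D m \<in> borel_measurable borel" for n m
    unfolding K_def by (rule reach_measurable[OF transition_kernel[OF hn0]]) auto
  have W_meas [measurable]: "W n \<in> borel_measurable borel" for n
    unfolding W_def[abs_def] by measurable
  note [measurable] = transition_op_measurable[OF h0]
  have tm: "g \<in> borel_measurable (transition h y)" if "g \<in> borel_measurable borel" for g :: "'x \<Rightarrow> ennreal" and y
    using that by (simp add: transition_def)
  have grid_bound: "ennreal (q * (t / (2 * h))) * (\<integral>\<^sup>+x. indicator ?B x * kernel_op (transition h) (W n) x \<partial>\<pi>)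
      \<le> emeasure \<pi> ?C" if n: "h / 2 ^ n \<le> t / 2" for n
  proof -
    interpret stationary_kernel borel "K n" \<pi>
      unfolding K_def by (rule transition_stationary[OF inv hn0])
    define d where "d = h / 2 ^ n"
    have d: "0 < d" "0 \<le> d" using h by (auto simp: d_def)
    define k where "k = nat \<lfloor>t / d\<rfloor>"
    have k: "real k \<le> t / d" "t / d - 1 < real k"
      using t d unfolding k_def by (auto simp: of_nat_nat)
    have kd: "real k * d \<le> t" using k(1) d by (simp add: field_simps)
    have "t / (2 * d) \<le> real k"
    proof -
      have "1 \<le> t / (2 * d)" using n d by (simp add: d_def[symmetric] field_simps)
      then show ?thesis using k(2) d by (simp add: field_simps)
    qed
    then have k_ge: "2 ^ n * (t / (2 * h)) \<le> real k" by (simp add: d_def mult.commute)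
    let ?U = "occupation (K n) ?B (indicator ?C)"
    let ?u = "of_nat k * ennreal q"
    have occ: "?u \<le> ?U k y" if y: "y \<in> ?D" for y
    proof -
      let ?S = "{\<omega> \<in> space M. \<forall>j<k. X (0 + real j * d) \<omega> \<in> ?C}"
      interpret Py: prob_space "P y" by (rule prob)
      have spF: "space M \<in> sets (F 0)" using sets.top[of "F 0"] by (simp add: F_space)
      have "q \<le> measure (P y) ?S" using stay[of y d k] y d kd by simp
      then have "ennreal q \<le> emeasure (P y) ?S"
        by (simp add: Py.emeasure_eq_measure)
      then have "?u \<le> of_nat k * emeasure (P y) ?S" by (rule mult_left_mono) simp
      also have "?S = space M \<inter> ?S" by blast
      also have "of_nat k * emeasure (P y) (space M \<inter> ?S)
        \<le> (\<integral>\<^sup>+\<omega>. indicator (space M) \<omega> * ?U k (X 0 \<omega>) \<partial>P y)"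
        unfolding K_def d_def[symmetric] using lr
        by (intro emeasure_stay_le[OF d(2) order_refl spF B C]) auto
      also have "\<dots> = (\<integral>\<^sup>+\<omega>. ?U k (X 0 \<omega>) \<partial>P y)"
        by (intro nn_integral_cong) (simp add: space_P)
      also have "\<dots> = ?U k y" by (rule integral_at_start) measurable
      finally show ?thesis .
    qed
    have [measurable]: "?U (k + 4 ^ n) \<in> borel_measurable borel" by measurable
    have pow: "(kernel_op (K n) ^^ (2 ^ n)) g x = kernel_op (transition h) g x"
      if "g \<in> borel_measurable borel" for g x
      unfolding K_def using transition_op_pow[OF hn0 that, of "2 ^ n" n x] by simp
    have "of_nat (2 ^ n) * (ennreal (q * (t / (2 * h)))
        * (\<integral>\<^sup>+x. indicator ?B x * kernel_op (transition h) (W n) x \<partial>\<pi>))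
      \<le> ?u * (\<integral>\<^sup>+x. indicator ?B x * kernel_op (transition h) (W n) x \<partial>\<pi>)"
    proof -
      have "of_nat (2 ^ n) * ennreal (q * (t / (2 * h))) = ennreal (2 ^ n * (t / (2 * h)) * q)"
        using q t h by (simp add: ennreal_of_nat_eq_real_of_nat ennreal_mult[symmetric] mult_ac)
      also have "\<dots> \<le> ennreal (real k * q)"
        using k_ge q by (intro ennreal_leI mult_right_mono)
      also have "\<dots> = ?u" using q by (simp add: ennreal_of_nat_eq_real_of_nat ennreal_mult)
      finally show ?thesis unfolding mult.assoc[symmetric] by (intro mult_right_mono) auto
    qed
    also have "\<dots> = (\<integral>\<^sup>+x. indicator ?B x * kernel_op (transition h) (\<lambda>y. ?u * W n y) x \<partial>\<pi>)"
    proof -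
      have "kernel_op (transition h) (\<lambda>y. ?u * W n y) x = ?u * kernel_op (transition h) (W n) x" for x
        by (rule kernel_op_cmult) (rule tm, measurable)
      then have "(\<integral>\<^sup>+x. indicator ?B x * kernel_op (transition h) (\<lambda>y. ?u * W n y) x \<partial>\<pi>)
        = (\<integral>\<^sup>+x. ?u * (indicator ?B x * kernel_op (transition h) (W n) x) \<partial>\<pi>)"
        by (simp only: mult_ac)
      also have "\<dots> = ?u * (\<integral>\<^sup>+x. indicator ?B x * kernel_op (transition h) (W n) x \<partial>\<pi>)"
        by (rule nn_integral_cmult) measurable
      finally show ?thesis by simp
    qed
    also have "\<dots> \<le> (\<integral>\<^sup>+x. indicator ?B x * kernel_op (transition h) (?U (k + 4 ^ n)) x \<partial>\<pi>)"
    proof (intro nn_integral_mono mult_left_mono kernel_op_mono)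
      fix y
      have "?u * W n y \<le> ?u * reach (K n) ?B ?D (4 ^ n) y"
        unfolding W_def by (intro mult_left_mono) (auto simp: indicator_def)
      also have "\<dots> \<le> ?U (k + 4 ^ n) y" by (rule reach_le_occupation[OF B D occ])
      finally show "?u * W n y \<le> ?U (k + 4 ^ n) y" .
    qed simp
    also have "\<dots> = (\<integral>\<^sup>+x. indicator ?B x * (kernel_op (K n) ^^ (2 ^ n)) (?U (k + 4 ^ n)) x \<partial>\<pi>)"
      by (subst pow) auto
    also have "\<dots> \<le> of_nat (2 ^ n) * (\<integral>\<^sup>+x. indicator ?C x \<partial>\<pi>)"
      by (rule occupation_after_steps_le) (auto simp: indicator_def)
    also have "(\<integral>\<^sup>+x. indicator ?C x \<partial>\<pi>) = emeasure \<pi> ?C" by simp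
    finally show ?thesis
      by (subst (asm) ennreal_mult_le_mult_iff) (auto simp: power_eq_top_ennreal)
  qed
  have W_liminf: "ennreal c0 * indicator ?A y \<le> liminf (\<lambda>n. W n y)" for y
  proof (cases "y \<in> ?A")
    case True
    then have "ennreal c0 \<le> ennreal (measure (P y) {\<omega> \<in> space (P y). time_above V X R \<omega> < time_below V X l \<omega>})"
      by (intro ennreal_leI climb) simp
    also have "\<dots> \<le> liminf (\<lambda>n. reach (K n) ?B ?D (4 ^ n) y)"
      unfolding K_def by (rule hitting_prob_le_liminf_reach[OF V h])
    finally show ?thesis using True by (simp add: W_def)
  qed simp
  let ?a = "ennreal (q * (t / (2 * h)))"
  let ?G = "\<lambda>n x. indicator ?B x * kernel_op (transition h) (W n) x"
  have "ennreal c0 * (\<integral>\<^sup>+x. indicator ?B x * kernel_op (transition h) (indicator ?A) x \<partial>\<pi>)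
    = (\<integral>\<^sup>+x. ennreal c0 * (indicator ?B x * kernel_op (transition h) (indicator ?A) x) \<partial>\<pi>)"
    by (rule nn_integral_cmult[symmetric]) measurable
  also have "\<dots> \<le> (\<integral>\<^sup>+x. liminf (\<lambda>n. ?G n x) \<partial>\<pi>)"
  proof (rule nn_integral_mono)
    fix x
    show "ennreal c0 * (indicator ?B x * kernel_op (transition h) (indicator ?A) x) \<le> liminf (\<lambda>n. ?G n x)"
    proof (cases "x \<in> ?B")
      case True
      have "ennreal c0 * kernel_op (transition h) (indicator ?A) x
        = kernel_op (transition h) (\<lambda>y. ennreal c0 * indicator ?A y) x"
        by (rule kernel_op_cmult[symmetric]) (rule tm, measurable)
      also have "\<dots> \<le> (\<integral>\<^sup>+y. liminf (\<lambda>n. W n y) \<partial>transition h x)"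
        unfolding kernel_op_def by (intro nn_integral_mono W_liminf)
      also have "\<dots> \<le> liminf (\<lambda>n. kernel_op (transition h) (W n) x)"
        unfolding kernel_op_def by (rule nn_integral_liminf) (rule tm, measurable)
      finally show ?thesis using True by simp
    qed simp
  qed
  also have "\<dots> \<le> liminf (\<lambda>n. \<integral>\<^sup>+x. ?G n x \<partial>\<pi>)"
    by (rule nn_integral_liminf) measurable
  finally have "?a * (ennreal c0 * (\<integral>\<^sup>+x. indicator ?B x * kernel_op (transition h) (indicator ?A) x \<partial>\<pi>))
    \<le> ?a * liminf (\<lambda>n. \<integral>\<^sup>+x. ?G n x \<partial>\<pi>)"
    by (rule mult_left_mono) simp
  also have "\<dots> \<le> liminf (\<lambda>n. ?a * (\<integral>\<^sup>+x. ?G n x \<partial>\<pi>))"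
    by (rule mult_liminf_le)
  also have "\<dots> \<le> limsup (\<lambda>n. ?a * (\<integral>\<^sup>+x. ?G n x \<partial>\<pi>))"
    by (rule Liminf_le_Limsup) simp
  also have "\<dots> \<le> emeasure \<pi> ?C"
  proof (rule Limsup_bounded)
    have "(\<lambda>n. h * (1 / 2) ^ n) \<longlonglongrightarrow> 0"
      by (intro tendsto_mult_right_zero LIMSEQ_power_zero) auto
    from order_tendstoD(2)[OF this, of "t / 2"] t
    have "\<forall>\<^sub>F n in sequentially. h * (1 / 2) ^ n < t / 2" by simp
    then show "\<forall>\<^sub>F n in sequentially. ?a * (\<integral>\<^sup>+x. ?G n x \<partial>\<pi>) \<le> emeasure \<pi> ?C"
      by eventually_elim (rule grid_bound, simp add: power_divide)
  qed
  finally show ?thesis .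
qed

end

lemma tlog_ge_1: "1 \<le> tlog x"
proof (cases "x < exp 1")
  case False
  then have "ln (exp 1) \<le> ln x" by (subst ln_le_cancel_iff) (auto simp: not_less intro: less_le_trans[OF exp_gt_zero])
  then show ?thesis using False by (simp add: tlog_def)
qed (simp add: tlog_def)

theorem theorem2p1:
  fixes M :: "'w measure"
    and F :: "real \<Rightarrow> 'w measure"
    and P :: "'x::metric_space \<Rightarrow> 'w measure"
    and X :: "real \<Rightarrow> 'w \<Rightarrow> 'x"
    and \<pi> :: "'x measure"
    and V :: "'x \<Rightarrow> real"
    and \<phi> \<Psi> :: "real \<Rightarrow> real"
    and q \<epsilon> :: real
  assumes "cadlag_strong_Markov M F P X"
    and "harris_recurrent P X"
    and "invariant_prob P X \<pi>"
    and "ergodic P X \<pi>"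
    and "condition_L F P X V \<phi> \<Psi>"
    and "0 < q" "q < 1" "0 < \<epsilon>" "\<epsilon> < 1"
  shows "\<exists>c. 0 < c \<and> c < 1 \<and>
    (\<forall>r\<ge>1. c / L_rate \<phi> \<Psi> \<epsilon> q r \<le> measure \<pi> {x. V x \<ge> r})"
proof -
  interpret cadlag_strong_Markov M F P X by fact
  note inv = \<open>invariant_prob P X \<pi>\<close>
  obtain l0 where V1: "\<And>x. 1 \<le> V x" and V: "continuous_on UNIV V"
    and unbounded: "\<And>x. AE \<omega> in P x. Limsup at_top (\<lambda>t. ereal (V (X t \<omega>))) = \<infinity>"
    and l0: "1 \<le> l0" and drift: "L_drift F P X V \<phi> l0" and tail: "L_tail P X V \<Psi> l0"
    using \<open>condition_L F P X V \<phi> \<Psi>\<close> unfolding condition_L_def by blast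
  from drift obtain b where \<phi>0: "\<And>u. u \<in> {0<..1} \<Longrightarrow> 0 \<le> \<phi> u" and \<phi>_mono: "mono_on {0<..1} \<phi>"
    and \<phi>_cont: "continuous_on {0<..1} \<phi>" and dec: "strict_antimono_on {1..} (\<lambda>r. r * \<phi> (1 / r))"
    and b: "0 \<le> b"
    and sm: "\<And>x. supermartingale (P x) F
        (\<lambda>t \<omega>. 1 / V (X t \<omega>) - (LBINT u:{0..t}. \<phi> (1 / V (X u \<omega>)))
           - b * (LBINT u:{0..t}. indicator {y. V y \<le> l0} (X u \<omega>)))"
    unfolding L_drift_def by blast
  interpret pi: prob_space \<pi> using inv by (simp add: invariant_prob_def)
  have s\<pi>: "sets \<pi> = sets borel" using inv by (simp add: invariant_prob_def)
  have sp: "space \<pi> = UNIV" using sets_eq_imp_space_eq[OF s\<pi>] by simp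
  have V_meas: "V \<in> borel_measurable borel" by (rule borel_measurable_continuous_onI[OF V])
  have Vset: "{y. V y < a} \<in> sets \<pi>" "{y. a \<le> V y} \<in> sets \<pi>" for a
    using measurable_sets[OF V_meas, of "{..<a}"] measurable_sets[OF V_meas, of "{a..}"]
    by (auto simp: vimage_def s\<pi>)
  define w where "w r = r * \<phi> (1 / r)" for r
  have w_less: "w s < w r" if "1 \<le> r" "r < s" for r s
    using monotone_onD[OF dec, of r s] that unfolding w_def by simp
  have w_pos: "0 < w r" if "1 \<le> r" for r
  proof -
    have "0 \<le> w (r + 1)" using that unfolding w_def by (intro mult_nonneg_nonneg \<phi>0) auto
    with w_less[of r "r + 1"] that show ?thesis by simp
  qed
  have \<Psi>1: "1 \<le> \<Psi> r" if "1 \<le> r" for r using tail that unfolding L_tail_def by blast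

  obtain l where l: "l0 < l" "0 < emeasure \<pi> {y. V y < l}"
  proof -
    have "\<exists>n::nat. 0 < emeasure \<pi> {y. V y < l0 + 1 + real n}"
    proof (rule ccontr)
      assume "\<not> ?thesis"
      then have "emeasure \<pi> (\<Union>n::nat. {y. V y < l0 + 1 + real n}) = 0"
        by (intro emeasure_UN_eq_0) (auto simp: Vset not_gr_zero)
      moreover have "(\<Union>n::nat. {y. V y < l0 + 1 + real n}) = space \<pi>"
      proof -
        have "\<exists>n::nat. V y < l0 + 1 + real n" for y
          using reals_Archimedean2[of "V y - l0 - 1"] by (auto simp: algebra_simps)
        then show ?thesis by (auto simp: sp)
      qed
      ultimately show False using pi.emeasure_space_1 by simp
    qed
    then obtain n :: nat where "0 < emeasure \<pi> {y. V y < l0 + 1 + real n}" ..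
    then show ?thesis by (intro that[of "l0 + 1 + real n"]) auto
  qed
  from tail l(1) obtain C where C: "0 < C"
    and climb: "\<And>r x. l + 1 < r \<Longrightarrow> l + 1 \<le> V x \<Longrightarrow>
      C / \<Psi> r \<le> measure (P x) {\<omega> \<in> space (P x). time_above V X r \<omega> < time_below V X l \<omega>}"
    unfolding L_tail_def by blast
  obtain h where h: "0 < h" and p_pos: "0 < (\<integral>\<^sup>+x. indicator {y. V y < l} x *
    kernel_op (transition h) (indicator {y. l + 1 \<le> V y}) x \<partial>\<pi>)" (is "0 < ?p")
    using exists_upcrossing_time[OF inv V unbounded l(2)] by blast
  obtain p where p: "0 < p" "ennreal p \<le> ?p"
  proof (cases ?p)
    case (real p)
    then show ?thesis using that[of p] p_pos by auto
  next
    case top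
    then show ?thesis using that[of 1] by simp
  qed

  define \<kappa> where "\<kappa> = q * (1 - q) * C * p / (4 * h)"
  have \<kappa>: "0 < \<kappa>" using \<open>0 < q\<close> \<open>q < 1\<close> C p h by (simp add: \<kappa>_def)
  \<comment> \<open>\<open>\<kappa>\<close> collects the factor \<open>q t C p / (2 h)\<close> with \<open>t = (1 - q) / (2 w r)\<close>.\<close>
  have large: "\<kappa> / (w r * \<Psi> (2 * r / (1 - q))) \<le> measure \<pi> {x. r \<le> V x}" if r: "l \<le> r" for r
  proof -
    define R where "R = 2 * r / (1 - q)"
    define t where "t = (1 - q) / (2 * w r)"
    have r1: "1 < r" using r l l0 by simp
    have w: "0 < w r" using w_pos r1 by simp
    have R: "2 * r < R" using \<open>0 < q\<close> \<open>q < 1\<close> r1 by (simp add: R_def field_simps)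
    have t: "0 < t" using w \<open>q < 1\<close> by (simp add: t_def)
    have stay: "q \<le> measure (P y) {\<omega> \<in> space M. \<forall>j<n. r \<le> V (X (real j * d) \<omega>)}"
      if y: "R < V y" and d: "0 < d" and nd: "real n * d \<le> t" for y n d
    proof -
      have "r / V y \<le> r / R" using y R r1 by (intro divide_left_mono) auto
      also have "r / R = (1 - q) / 2" using r1 \<open>q < 1\<close> by (simp add: R_def)
      finally have 1: "r / V y \<le> (1 - q) / 2" .
      have "w r * (real n * d) \<le> w r * t" using nd w by (intro mult_left_mono) auto
      also have "\<dots> = (1 - q) / 2" using w by (simp add: t_def)
      finally have 2: "r * \<phi> (1 / r) * (real n * d) \<le> (1 - q) / 2" by (simp add: w_def)
      have "1 - r / V y - r * \<phi> (1 / r) * (real n * d)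
        \<le> measure (P y) {\<omega> \<in> space M. \<forall>j<n. r \<le> V (X (real j * d) \<omega>)}"
        using r1 r l y R d
        by (intro stay_above_prob_ge[OF V V1 \<phi>0 \<phi>_mono \<phi>_cont b sm]) auto
      with 1 2 show ?thesis by simp
    qed
    have \<Psi>R: "1 \<le> \<Psi> R" using R r1 by (intro \<Psi>1) simp
    have "ennreal (\<kappa> / (w r * \<Psi> R)) = ennreal (q * (t / (2 * h))) * (ennreal (C / \<Psi> R) * ennreal p)"
      using \<open>0 < q\<close> \<open>q < 1\<close> C p h t w \<Psi>R
      by (simp add: ennreal_mult[symmetric] \<kappa>_def t_def field_simps)
    also have "\<dots> \<le> ennreal (q * (t / (2 * h))) * (ennreal (C / \<Psi> R) * ?p)"
      using p by (intro mult_left_mono) auto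
    also have "\<dots> \<le> emeasure \<pi> {y. r \<le> V y}"
      using climb R r1 r \<open>0 < q\<close>
      by (intro invariant_tail_ge[OF inv V h t _ r stay]) auto
    finally show ?thesis
      using \<kappa> w \<Psi>R by (simp add: R_def pi.emeasure_eq_measure)
  qed

  let ?\<Psi>l = "\<Psi> (2 * l / (1 - q))"
  have arg1: "1 \<le> 2 * r / (1 - q)" if "1 \<le> r" for r
    using that \<open>0 < q\<close> \<open>q < 1\<close> by (simp add: field_simps)
  have l1: "1 \<le> l" using l l0 by simp
  have \<Psi>l: "1 \<le> ?\<Psi>l" by (intro \<Psi>1 arg1 l1)
  \<comment> \<open>For \<open>r < l\<close> the tail at \<open>l\<close> is used, which costs the additional factor \<open>\<Psi>(2l / (1 - q)) \<ge> 1\<close>.\<close>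
  define c where "c = min (1 / 2) (\<kappa> / ?\<Psi>l)"
  have c: "0 < c" "c < 1" "c \<le> \<kappa> / ?\<Psi>l" using \<kappa> \<Psi>l by (auto simp: c_def)
  have rate_ge: "w r * \<Psi> (2 * r / (1 - q)) \<le> L_rate \<phi> \<Psi> \<epsilon> q r" if "1 \<le> r" for r
  proof -
    have "1 \<le> tlog (tlog r) powr \<epsilon>" using tlog_ge_1 \<open>0 < \<epsilon>\<close> by (intro ge_one_powr_ge_zero) auto
    then have "w r * \<Psi> (2 * r / (1 - q)) * 1 \<le> w r * \<Psi> (2 * r / (1 - q)) * tlog (tlog r) powr \<epsilon>"
      using w_pos[OF that] \<Psi>1[OF arg1[OF that]] by (intro mult_left_mono) auto
    then show ?thesis by (simp add: L_rate_def w_def)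
  qed
  have "c / L_rate \<phi> \<Psi> \<epsilon> q r \<le> measure \<pi> {x. r \<le> V x}" if r: "1 \<le> r" for r
  proof -
    have pos: "0 < w r * \<Psi> (2 * r / (1 - q))"
      using w_pos[OF r] \<Psi>1[OF arg1[OF r]] by (intro mult_pos_pos) auto
    have "c / L_rate \<phi> \<Psi> \<epsilon> q r \<le> c / (w r * \<Psi> (2 * r / (1 - q)))"
      using c by (intro divide_left_mono rate_ge[OF r] mult_pos_pos[OF less_le_trans[OF pos rate_ge[OF r]] pos]) simp
    also have "\<dots> \<le> measure \<pi> {x. r \<le> V x}"
    proof (cases "l \<le> r")
      case True
      have "\<kappa> / ?\<Psi>l \<le> \<kappa>" using \<kappa> \<Psi>l by (simp add: divide_le_eq)
      then have "c / (w r * \<Psi> (2 * r / (1 - q))) \<le> \<kappa> / (w r * \<Psi> (2 * r / (1 - q)))"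
        using c pos by (intro divide_right_mono) auto
      with large[OF True] show ?thesis by linarith
    next
      case False
      have "w l \<le> w r * \<Psi> (2 * r / (1 - q))"
      proof -
        have "w l \<le> w r * 1" using w_less[OF r, of l] False by simp
        also have "\<dots> \<le> w r * \<Psi> (2 * r / (1 - q))"
          using w_pos[OF r] \<Psi>1[OF arg1[OF r]] by (intro mult_left_mono) auto
        finally show ?thesis .
      qed
      then have "c / (w r * \<Psi> (2 * r / (1 - q))) \<le> c / w l"
        using c by (intro divide_left_mono mult_pos_pos[OF pos w_pos[OF l1]]) auto
      also have "\<dots> \<le> \<kappa> / ?\<Psi>l / w l"
        using c w_pos[OF l1] by (intro divide_right_mono) auto
      also have "\<dots> = \<kappa> / (w l * ?\<Psi>l)" by (simp add: mult.commute)
      also have "\<dots> \<le> measure \<pi> {x. l \<le> V x}" by (rule large) simp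
      also have "\<dots> \<le> measure \<pi> {x. r \<le> V x}"
        using False by (intro pi.finite_measure_mono Vset) auto
      finally show ?thesis .
    qed
    finally show ?thesis .
  qed
  with c show ?thesis by blast
qed

end
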